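(* Let $f:\mathbb{R}^d\to\mathbb{R}$ be differentiable and $L$-smooth ($\|\nabla f(x)-\nabla f(y)\|\le L\|x-y\|$ for all $x,y$), $\Delta=f(w^0)-\inf_xf(x)$ where $w^0$ is the starting point, and let the stochastic gradients satisfy $\mathbb{E}_\xi[\nabla f(x;\xi)]=\nabla f(x)$ and $\mathbb{E}_\xi[\|\nabla f(x;\xi)-\nabla f(x)\|^2]\le\sigma^2$ for all $x\in\mathbb{R}^d$, $\xi\sim\mathcal D$. Let $\varepsilon>0$. Consider any SGD method represented by a computation tree $G=(V,E)$. Let $\{x^k\}_{k\ge0}$ be a main branch of $G$ and $\{(\gamma_k,z^k,\xi^k)\}_{k\ge0}$ the corresponding auxiliary sequence, satisfying: (1) For all $k\ge0$, $\xi^k$ is statistically independent of $\{(x^{i+1},z^{i+1},\xi^i)\}_{i=0}^{k-1}$. (2) $\mathrm{repr}(z^k)\subseteq\mathrm{repr}(x^k)$ for all $k\ge0$. (3) There exists a constant $R\in[0,\infty]$ such that $\mathrm{dist}(x^k,z^k)\le R$ for all $k\ge0$. (4) The step sizes along the main branch satisfy $\gamma_k=\gamma_g:=\min\{\frac1{2L},\frac1{4RL},\frac{\varepsilon}{8\sigma^2L}\}$ for all $k\ge0$. Any other step size $\gamma$ can be taken as large as $\sqrt{\frac{R}{(j+1)(\log R+1)}}\,\gamma_g$ (with the convention $\frac{0}{\log 0+1}=0$ for $R=0$), where $j=\mathrm{dist}(y,\{x^k\})$ and $y$ is the node at which the step $y-\gamma\nabla f(\cdot;\cdot)$ with this step size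 $\gamma$ is applied to find a new node. Then $\frac1K\sum_{k=0}^{K-1}\mathbb{E}[\|\nabla f(x^k)\|^2]\le\varepsilon$ for all $$K\ge\frac{8(R+1)L\Delta}{\varepsilon}+\frac{16\sigma^2L\Delta}{\varepsilon^2}.$$
   Context: Computation tree (Birch SGD framework): start with the node set $V=\{w^0\}$ and edge set $E=\emptyset$. At each step $k=0,1,2,\dots$ choose points $w_{\mathrm{base}},w_{\mathrm{grad}}\in V$ and a step size $\gamma>0$, compute $w^{k+1}=w_{\mathrm{base}}-\gamma\nabla f(w_{\mathrm{grad}};\zeta)$ with $\zeta\sim\mathcal D$ (the sample $\zeta$ may be reused), add $w^{k+1}$ to $V$ and add the directed weighted edge $(w_{\mathrm{base}},w^{k+1},\gamma\nabla f(w_{\mathrm{grad}};\zeta))$ to $E$. The resulting weighted directed tree $G=(V,E)$ is the computation tree. Main branch and auxiliary sequence: a sequence $\{x^k\}_{k\ge0}$ is a main branch if it is a path in $G$ starting at $x^0\equiv w^0$, i.e. $x^{k+1}$ is a direct successor of $x^k$ for every $k$. Then for each $k$ there is a unique triple $(\gamma_k,z^k,\xi^k)$ with $\gamma_k>0$, $z^k\in V$, $\xi^k\sim\mathcal D$ and $x^{k+1}=x^k-\gamma_k\nabla f(z^k;\xi^k)$; the sequence of these triples is the auxiliary sequence. Tree distance: for $y,z\in V$, $\mathrm{dist}(y,z)$ is the maximum of the numbers of edges separating $y$ and $z$, respectively, from their closest common ancestor in $G$. For $y\in V$ and a main branch, $\mathrm{dist}(y,\{x^k\})=\min_{k\ge0}\mathrm{dist}(y,x^k)$.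 Representation: for $y\in V$, writing $y=w^0-\sum_{j=1}^p\gamma_j\nabla f(m^j;\kappa^j)$ along the path from $w^0$ to $y$, $\mathrm{repr}(y)$ is the multiset $\{(m^1,\kappa^1),\dots,(m^p,\kappa^p)\}$ (ignoring step sizes); $\subseteq$ is multiset inclusion. *)

theory Defs
  imports "HOL-Probability.Probability"
begin

text \<open>
  The nodes of a computation tree are the natural numbers: node \<open>n\<close> is the point that is the
  \<open>n\<close>-th to be computed, and node \<open>0\<close> is the root. For \<open>n > 0\<close>, the numbers \<open>base n < n\<close> and
  \<open>grad n < n\<close> are the nodes playing the roles of \<open>w_base\<close> and \<open>w_grad\<close> in the step that creates
  node \<open>n\<close>; \<open>step n\<close> is the step size and \<open>sample n\<close> the (possibly reused) random sample of that
  step. The shape of the tree and the step sizes are deterministic; the point \<open>w n\<close> sitting at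
  node \<open>n\<close> is a random vector. The values of \<open>base\<close>, \<open>grad\<close>, \<open>step\<close> and \<open>sample\<close> at \<open>0\<close> are
  irrelevant. In \<open>g y s\<close>, the point is \<open>y\<close> and the sample is \<open>s\<close>.
\<close>

locale computation_tree =
  fixes M :: "'w measure" and D :: "'s measure"
    and g :: "real ^ 'd \<Rightarrow> 's \<Rightarrow> real ^ 'd" and w0 :: "real ^ 'd"
    and base grad :: "nat \<Rightarrow> nat" and step :: "nat \<Rightarrow> real"
    and sample :: "nat \<Rightarrow> 'w \<Rightarrow> 's" and w :: "nat \<Rightarrow> 'w \<Rightarrow> real ^ 'd"
  assumes base_less: "n > 0 \<Longrightarrow> base n < n"
    and grad_less: "n > 0 \<Longrightarrow> grad n < n"
    and step_pos: "n > 0 \<Longrightarrow> step n > 0"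
    and sample_measurable: "n > 0 \<Longrightarrow> sample n \<in> M \<rightarrow>\<^sub>M D"
    and sample_distr: "n > 0 \<Longrightarrow> distr M D (sample n) = D"
    and root: "w 0 = (\<lambda>\<omega>. w0)"
    and node: "n > 0 \<Longrightarrow>
      w n = (\<lambda>\<omega>. w (base n) \<omega> - step n *\<^sub>R g (w (grad n) \<omega>) (sample n \<omega>))"

definition tree_edges :: "(nat \<Rightarrow> nat) \<Rightarrow> (nat \<times> nat) set" where
  "tree_edges base = {(base n, n) | n. n > 0}"

definition ancestor :: "(nat \<Rightarrow> nat) \<Rightarrow> nat \<Rightarrow> nat \<Rightarrow> bool" where
  "ancestor base a y \<longleftrightarrow> (a, y) \<in> (tree_edges base)\<^sup>*"

definition edges_between :: "(nat \<Rightarrow> nat) \<Rightarrow> nat \<Rightarrow> nat \<Rightarrow> nat" where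
  "edges_between base a y = (LEAST n. (a, y) \<in> tree_edges base ^^ n)"

definition closest_common_ancestor :: "(nat \<Rightarrow> nat) \<Rightarrow> nat \<Rightarrow> nat \<Rightarrow> nat" where
  "closest_common_ancestor base y z =
    (THE a. ancestor base a y \<and> ancestor base a z \<and>
      (\<forall>b. ancestor base b y \<and> ancestor base b z \<longrightarrow> ancestor base b a))"

definition tree_dist :: "(nat \<Rightarrow> nat) \<Rightarrow> nat \<Rightarrow> nat \<Rightarrow> nat" where
  "tree_dist base y z =
    max (edges_between base (closest_common_ancestor base y z) y)
        (edges_between base (closest_common_ancestor base y z) z)"

definition branch_dist :: "(nat \<Rightarrow> nat) \<Rightarrow> nat \<Rightarrow> (nat \<Rightarrow> nat) \<Rightarrow> nat" where
  "branch_dist base y x = (INF k. tree_dist base y (x k))"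

definition main_branch :: "(nat \<Rightarrow> nat) \<Rightarrow> (nat \<Rightarrow> nat) \<Rightarrow> bool" where
  "main_branch base x \<longleftrightarrow> x 0 = 0 \<and> (\<forall>k. (x k, x (Suc k)) \<in> tree_edges base)"

definition auxiliary_sequence ::
  "(nat \<Rightarrow> nat) \<Rightarrow> (nat \<Rightarrow> real) \<Rightarrow> (nat \<Rightarrow> 'w \<Rightarrow> 's) \<Rightarrow> (nat \<Rightarrow> nat) \<Rightarrow>
    (nat \<Rightarrow> real) \<Rightarrow> (nat \<Rightarrow> nat) \<Rightarrow> (nat \<Rightarrow> 'w \<Rightarrow> 's) \<Rightarrow> bool" where
  "auxiliary_sequence grad step sample x \<gamma> z \<xi> \<longleftrightarrow>
    (\<forall>k. \<gamma> k = step (x (Suc k)) \<and> z k = grad (x (Suc k)) \<and> \<xi> k = sample (x (Suc k)))"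

text \<open>
  The edge into node \<open>n\<close> lies on the path from the root to \<open>y\<close> iff \<open>n > 0\<close> and \<open>n\<close> is an ancestor
  of \<open>y\<close> or \<open>y\<close> itself. The entries of the multiset are pairs of random variables: a random
  point and a random sample. The index set is finite in a computation tree.
\<close>

definition repr ::
  "(nat \<Rightarrow> nat) \<Rightarrow> (nat \<Rightarrow> nat) \<Rightarrow> (nat \<Rightarrow> 'w \<Rightarrow> 's) \<Rightarrow> (nat \<Rightarrow> 'w \<Rightarrow> real ^ 'd) \<Rightarrow>
    nat \<Rightarrow> (('w \<Rightarrow> real ^ 'd) \<times> ('w \<Rightarrow> 's)) multiset" where
  "repr base grad sample w y =
    image_mset (\<lambda>n. (w (grad n), sample n)) (mset_set {n. n > 0 \<and> ancestor base n y})"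

text \<open>
  Independence of the generated sigma-algebras. The library's \<^const>\<open>prob_space.indep_var\<close> is the
  same notion, restricted to two variables with values in the same type.
\<close>

definition independent_vars ::
  "'w measure \<Rightarrow> 'b measure \<Rightarrow> ('w \<Rightarrow> 'b) \<Rightarrow> 'c measure \<Rightarrow> ('w \<Rightarrow> 'c) \<Rightarrow> bool" where
  "independent_vars M N X N' Y \<longleftrightarrow>
    prob_space.indep_set M (sets (vimage_algebra (space M) X N))
                           (sets (vimage_algebra (space M) Y N'))"

text \<open>
  In \<^typ>\<open>ereal\<close>, a positive number divided by \<open>0\<close> is \<open>\<infinity>\<close>, so a term with \<open>R = 0\<close> or \<open>\<sigma> = 0\<close> drops
  out of the minimum; for \<open>R = \<infinity>\<close> the value is \<open>0\<close>.
\<close>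

definition main_step :: "real \<Rightarrow> real \<Rightarrow> real \<Rightarrow> ereal \<Rightarrow> ereal" where
  "main_step L \<sigma> \<epsilon> R =
    min (1 / (2 * ereal L))
      (min (1 / (4 * R * ereal L)) (ereal \<epsilon> / (8 * ereal (\<sigma>\<^sup>2) * ereal L)))"

text \<open>
  The value for \<open>R = \<infinity>\<close> is immaterial: then \<^const>\<open>main_step\<close> is \<open>0\<close>, while step sizes are positive.
\<close>

definition aux_step_factor :: "ereal \<Rightarrow> nat \<Rightarrow> real" where
  "aux_step_factor R j =
    (let r = real_of_ereal R
     in if r = 0 then 0 else sqrt (r / ((real j + 1) * (ln r + 1))))"

end

theory Submission
  imports Defs
begin

text \<open>
  Along the main branch, the method is gradient descent with step size \<open>\<gamma>\<close>, except that step \<open>k\<close> uses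
  a stochastic gradient at \<open>z k\<close> instead of \<open>x k\<close>. The descent inequality for an \<open>L\<close>-smooth function
  therefore has an error term, the square of the difference of the gradients at \<open>x k\<close> and \<open>z k\<close>, which
  is at most \<open>L\<^sup>2\<close> times the squared distance of the two points.

  The tree structure bounds this distance. Behind their closest common ancestor, which is at most \<open>R\<close>
  edges away, \<open>z k\<close> has been reached with stochastic gradients that also occur on the main branch, so
  that \<open>x k - z k\<close> is a linear combination of at most \<open>R\<close> main stochastic gradients. The admissible
  sizes of the other steps have a harmonic profile, which keeps the sum of the squares of the
  coefficients below \<open>2 R \<gamma>\<^sup>2\<close> (\<open>delayed_main_branch\<close>).

  The rest is a statement about gradient descent with such a delay, the locale \<open>delayed_sgd\<close>. Each
  sample is independent of the past, so the noise terms are orthogonal to the past and to each other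
  (\<open>noise_orthogonal\<close>, \<open>noise_sum_le\<close>). The squared distance is thus in the mean at most
  \<open>4 R \<gamma>\<^sup>2\<close> times the sum of \<open>\<sigma>\<^sup>2\<close> and of the mean squared gradients at the last \<open>R\<close> or fewer points
  \<open>z i\<close> (\<open>delay_sq_mean\<close>). Summed over \<open>k\<close>, each \<open>z i\<close> is counted at most \<open>R\<close> times
  (\<open>sum_drift_le\<close>), and as \<open>R L \<gamma> \<le> 1/4\<close> the error is absorbed by the term with the gradients at
  \<open>z k\<close> in the descent inequality (\<open>sum_descent\<close>). What remains is to compare constants: the cruder
  estimate that forgets the gradients at \<open>z k\<close> loses a factor of \<open>2\<close>, which is too much for the
  stated number of steps when the noise determines the step size; \<open>scaled_rate\<close> treats that regime
  separately.
\<close>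

section \<open>Combinatorics of the computation tree\<close>

text \<open>
  The inclusion of representations is a multiset inclusion of labels, possibly with repetitions.
  This turns it into an injection between the indices, so that the side steps and the main steps
  can be paired off and their step sizes subtracted.
\<close>

lemma image_mset_mset_set_subset_matching:
  assumes "finite A" and "finite B"
    and "image_mset f (mset_set A) \<subseteq># image_mset h (mset_set B)"
  obtains \<phi> where "inj_on \<phi> A" and "\<phi> ` A \<subseteq> B" and "\<And>a. a \<in> A \<Longrightarrow> f a = h (\<phi> a)"
proof -
  have "\<exists>\<phi>. inj_on \<phi> A \<and> \<phi> ` A \<subseteq> B \<and> (\<forall>a\<in>A. f a = h (\<phi> a))"
    using assms
  proof (induction A arbitrary: B rule: finite_induct)
    case empty
    then show ?case by simp
  next
    case (insert a A)
    from insert.hyps insert.prems(2)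
    have sub: "add_mset (f a) (image_mset f (mset_set A)) \<subseteq># image_mset h (mset_set B)"
      by simp
    then have "f a \<in># image_mset h (mset_set B)"
      by (meson mset_subset_eq_insertD)
    then obtain b where b: "b \<in> B" "f a = h b"
      using insert.prems(1) by auto
    from b(1) insert.prems(1) have "image_mset h (mset_set B) = add_mset (h b) (image_mset h (mset_set (B - {b})))"
      by (simp add: mset_set.remove)
    with sub b(2) have "image_mset f (mset_set A) \<subseteq># image_mset h (mset_set (B - {b}))"
      by simp
    with insert.IH[of "B - {b}"] insert.prems(1)
    obtain \<phi> where \<phi>: "inj_on \<phi> A" "\<phi> ` A \<subseteq> B - {b}" "\<forall>a\<in>A. f a = h (\<phi> a)"
      by auto
    have "inj_on (\<phi>(a := b)) (insert a A)"
      using \<phi>(1,2) insert.hyps(2) by (auto simp: inj_on_def)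
    moreover have "(\<phi>(a := b)) ` insert a A \<subseteq> B"
      using \<phi>(2) b(1) insert.hyps(2) by auto
    moreover have "\<forall>a'\<in>insert a A. f a' = h ((\<phi>(a := b)) a')"
      using \<phi>(3) b(2) by auto
    ultimately show ?case by blast
  qed
  then show thesis using that by blast
qed

context computation_tree
begin

definition path :: "nat \<Rightarrow> nat set" where
  "path y = {n. n > 0 \<and> ancestor base n y}"

lemma ancestor_refl [simp]: "ancestor base a a"
  by (simp add: ancestor_def)

lemma ancestor_trans: "ancestor base a b \<Longrightarrow> ancestor base b c \<Longrightarrow> ancestor base a c"
  by (simp add: ancestor_def)

lemma ancestor_rec: "ancestor base a y \<longleftrightarrow> a = y \<or> y > 0 \<and> ancestor base a (base y)"
  unfolding ancestor_def tree_edges_def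
  by (subst rtrancl.simps) auto

lemma ancestor_le: "ancestor base a y \<Longrightarrow> a \<le> y"
proof (induction y rule: less_induct)
  case (less y)
  then show ?case
    using ancestor_rec[of a y] base_less[of y] by fastforce
qed

lemma ancestor_root [simp]: "ancestor base 0 y"
proof (induction y rule: less_induct)
  case (less y)
  then show ?case
    using ancestor_rec[of 0 y] base_less[of y] by fastforce
qed

lemma ancestor_linear:
  "ancestor base a y \<Longrightarrow> ancestor base b y \<Longrightarrow> a \<le> b \<Longrightarrow> ancestor base a b"
proof (induction y rule: less_induct)
  case (less y)
  show ?case
  proof (cases "b = y")
    case False
    then have "y > 0" "ancestor base b (base y)"
      using less.prems(2) ancestor_rec[of b y] by auto
    moreover from this have "a \<noteq> y"
      using ancestor_le[of b "base y"] base_less[of y] less.prems(3) by auto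
    ultimately show ?thesis
      using less.prems ancestor_rec[of a y] less.IH[of "base y"] base_less[of y] by auto
  qed (use less.prems in simp)
qed

lemma path_root [simp]: "path 0 = {}"
  using ancestor_le by (fastforce simp: path_def)

lemma path_step: "n > 0 \<Longrightarrow> path n = insert n (path (base n))"
  unfolding path_def by (subst ancestor_rec) auto

lemma finite_path [simp]: "finite (path y)"
  by (rule finite_subset[of _ "{..y}"]) (auto simp: path_def dest: ancestor_le)

lemma not_in_path_base: "n > 0 \<Longrightarrow> n \<notin> path (base n)"
  using base_less[of n] ancestor_le[of n "base n"] by (auto simp: path_def)

lemma card_path_step: "n > 0 \<Longrightarrow> card (path n) = Suc (card (path (base n)))"
  by (simp add: path_step not_in_path_base)

lemma path_mono: "ancestor base a y \<Longrightarrow> path a \<subseteq> path y"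
  using ancestor_trans by (auto simp: path_def)

text \<open>
  Each edge adds exactly one node to the path from the root. Depths are therefore cardinalities of
  paths, and distances in the tree are differences of such cardinalities.
\<close>

lemma edges_between_eq:
  assumes "ancestor base a y"
  shows "edges_between base a y = card (path y) - card (path a)"
proof -
  have card: "card (path y) = card (path a) + n" if "(a, y) \<in> tree_edges base ^^ n" for n y
    using that
  proof (induction n arbitrary: y)
    case (Suc n)
    then obtain y' where "(a, y') \<in> tree_edges base ^^ n" "(y', y) \<in> tree_edges base"
      by auto
    with Suc.IH[of y'] show ?case
      by (auto simp: tree_edges_def card_path_step)
  qed simp
  obtain n where "(a, y) \<in> tree_edges base ^^ n"
    using assms unfolding ancestor_def rtrancl_power by blast
  then have "(a, y) \<in> tree_edges base ^^ edges_between base a y"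
    unfolding edges_between_def by (rule LeastI)
  from card[OF this] show ?thesis by simp
qed

lemma closest_common_ancestor:
  defines "c \<equiv> closest_common_ancestor base"
  shows "ancestor base (c y z) y" and "ancestor base (c y z) z"
    and "\<And>b. ancestor base b y \<Longrightarrow> ancestor base b z \<Longrightarrow> ancestor base b (c y z)"
proof -
  define S where "S = {b. ancestor base b y \<and> ancestor base b z}"
  have fin: "finite S"
    by (rule finite_subset[of _ "{..y}"]) (auto simp: S_def dest: ancestor_le)
  have "0 \<in> S" by (simp add: S_def)
  then have max: "Max S \<in> S" using fin by (intro Max_in) auto
  have anc: "ancestor base b (Max S)" if "b \<in> S" for b
    using that max fin ancestor_linear[of b y "Max S"] by (auto simp: S_def)
  have "c y z = Max S"
    unfolding c_def closest_common_ancestor_def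
  proof (rule the_equality)
    show "ancestor base (Max S) y \<and> ancestor base (Max S) z \<and>
      (\<forall>b. ancestor base b y \<and> ancestor base b z \<longrightarrow> ancestor base b (Max S))"
      using max anc by (auto simp: S_def)
  next
    fix a assume a: "ancestor base a y \<and> ancestor base a z \<and>
      (\<forall>b. ancestor base b y \<and> ancestor base b z \<longrightarrow> ancestor base b a)"
    then have "a \<in> S" by (simp add: S_def)
    then have "a \<le> Max S" using anc ancestor_le by blast
    moreover have "Max S \<le> a" using a max ancestor_le by (simp add: S_def)
    ultimately show "a = Max S" by simp
  qed
  with max anc show "ancestor base (c y z) y" "ancestor base (c y z) z"
    "\<And>b. ancestor base b y \<Longrightarrow> ancestor base b z \<Longrightarrow> ancestor base b (c y z)"
    by (auto simp: S_def)
qed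

lemma node_path:
  "w y \<omega> = w0 - (\<Sum>n\<in>path y. step n *\<^sub>R g (w (grad n) \<omega>) (sample n \<omega>))"
proof (induction y rule: less_induct)
  case (less y)
  show ?case
  proof (cases "y = 0")
    case True
    then show ?thesis by (simp add: root)
  next
    case False
    then have "w y \<omega> = w (base y) \<omega> - step y *\<^sub>R g (w (grad y) \<omega>) (sample y \<omega>)"
      using fun_cong[OF node[of y]] by simp
    also have "\<dots> = w0 - (\<Sum>n\<in>path y. step n *\<^sub>R g (w (grad n) \<omega>) (sample n \<omega>))"
      using False less.IH[of "base y"] base_less[of y]
      by (simp add: path_step not_in_path_base algebra_simps)
    finally show ?thesis .
  qed
qed

lemma node_measurable:
  assumes "(\<lambda>(y, s). g y s) \<in> borel_measurable (borel \<Otimes>\<^sub>M D)"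
  shows "w n \<in> borel_measurable M"
proof (induction n rule: less_induct)
  case (less n)
  show ?case
  proof (cases "n = 0")
    case True
    then show ?thesis by (simp add: root)
  next
    case False
    note assms[measurable]
    have [measurable]: "w (base n) \<in> borel_measurable M" "w (grad n) \<in> borel_measurable M"
      "sample n \<in> M \<rightarrow>\<^sub>M D"
      using False less.IH base_less[of n] grad_less[of n] sample_measurable[of n] by auto
    have "(\<lambda>\<omega>. (\<lambda>(y, s). g y s) (w (grad n) \<omega>, sample n \<omega>)) \<in> borel_measurable M"
      by measurable
    then have [measurable]: "(\<lambda>\<omega>. g (w (grad n) \<omega>) (sample n \<omega>)) \<in> borel_measurable M"
      by simp
    have "(\<lambda>\<omega>. w (base n) \<omega> - step n *\<^sub>R g (w (grad n) \<omega>) (sample n \<omega>)) \<in> borel_measurable M"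
      by measurable
    then show ?thesis
      using False node[of n] by simp
  qed
qed

lemma main_branch_simps:
  assumes "main_branch base x"
  shows "x 0 = 0" and "base (x (Suc k)) = x k" and "x (Suc k) > 0"
proof -
  have "(x k, x (Suc k)) \<in> tree_edges base" and "x 0 = 0"
    using assms unfolding main_branch_def by blast+
  then show "x 0 = 0" "base (x (Suc k)) = x k" "x (Suc k) > 0"
    by (simp_all add: tree_edges_def)
qed

lemma strict_mono_main_branch:
  assumes "main_branch base x"
  shows "strict_mono x"
  unfolding strict_mono_Suc_iff
proof
  fix k show "x k < x (Suc k)"
    using base_less[of "x (Suc k)"] main_branch_simps[OF assms] by simp
qed

lemma path_main_branch:
  assumes "main_branch base x"
  shows "path (x k) = (\<lambda>i. x (Suc i)) ` {..<k}"
proof (induction k)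
  case (Suc k)
  have "path (x (Suc k)) = insert (x (Suc k)) (path (x k))"
    using path_step[of "x (Suc k)"] main_branch_simps(2,3)[OF assms] by simp
  then show ?case by (simp add: Suc.IH lessThan_Suc)
qed (simp add: main_branch_simps[OF assms])

lemma card_path_main_branch:
  assumes "main_branch base x"
  shows "card (path (x k)) = k"
  unfolding path_main_branch[OF assms]
proof (subst card_image)
  show "inj_on (\<lambda>i. x (Suc i)) {..<k}"
    using strict_mono_eq[OF strict_mono_main_branch[OF assms]] by (simp add: inj_on_def)
qed simp

lemma ancestor_of_main_branch:
  assumes "main_branch base x" and "ancestor base a (x k)"
  obtains p where "p \<le> k" and "a = x p"
proof (cases "a = 0")
  case True
  then show thesis using that[of 0] main_branch_simps[OF assms(1)] by simp
next
  case False
  then have "a \<in> path (x k)" using assms(2) by (simp add: path_def)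
  then obtain i where "i < k" "a = x (Suc i)"
    unfolding path_main_branch[OF assms(1)] by auto
  then show thesis
    using that[of "Suc i"] by simp
qed

lemma ancestor_main_branch:
  assumes "main_branch base x" and "i \<le> k"
  shows "ancestor base (x i) (x k)"
proof (cases i)
  case 0
  then show ?thesis using main_branch_simps[OF assms(1)] by simp
next
  case (Suc j)
  then have "x i \<in> path (x k)"
    using assms(2) unfolding path_main_branch[OF assms(1)] by auto
  then show ?thesis by (simp add: path_def)
qed

text \<open>
  To be applied to the node \<open>a\<close> where the path to \<open>y\<close> leaves the main branch. Any common ancestor of \<open>y\<close> and
  a node of the main branch lies on the main branch, hence above \<open>a\<close>; so \<open>y\<close> is at least as far from
  the main branch as from \<open>a\<close>.
\<close>

lemma branch_dist_ge:
  assumes x: "main_branch base x" and a: "\<And>i. ancestor base (x i) y \<Longrightarrow> ancestor base (x i) a"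
  shows "card (path y) - card (path a) \<le> branch_dist base y x"
  unfolding branch_dist_def
proof (rule cINF_greatest)
  fix m
  define c where "c = closest_common_ancestor base y (x m)"
  have c: "ancestor base c y" "ancestor base c (x m)"
    by (simp_all add: c_def closest_common_ancestor(1,2))
  obtain p where "c = x p" using ancestor_of_main_branch[OF x c(2)] .
  then have "ancestor base c a" using a c(1) by simp
  then have "card (path c) \<le> card (path a)" by (intro card_mono path_mono) auto
  then have "card (path y) - card (path a) \<le> edges_between base c y"
    using edges_between_eq[OF c(1)] by simp
  then show "card (path y) - card (path a) \<le> tree_dist base y (x m)"
    by (simp add: tree_dist_def c_def)
qed simp

text \<open>
  The nodes between \<open>a\<close> and \<open>y\<close> have pairwise different, consecutive depths. A sum over a side
  branch that depends on depths only is thus a sum over an initial segment of the naturals.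
\<close>

lemma sum_path_diff:
  assumes "ancestor base a y"
  shows "(\<Sum>n\<in>path y - path a. h (card (path (base n)) - card (path a)))
    = (\<Sum>j<card (path y) - card (path a). h j)"
  using assms
proof (induction y rule: less_induct)
  case (less y)
  show ?case
  proof (cases "a = y")
    case False
    then have y: "y > 0" "ancestor base a (base y)"
      using less.prems ancestor_rec[of a y] by auto
    have "y \<notin> path a"
      using ancestor_le[OF y(2)] base_less[OF y(1)] ancestor_le[of y a] by (auto simp: path_def)
    then have *: "path y - path a = insert y (path (base y) - path a)"
      by (auto simp: path_step[OF y(1)])
    have "card (path a) \<le> card (path (base y))"
      using y(2) by (intro card_mono path_mono) auto
    then have **: "card (path y) - card (path a) = Suc (card (path (base y)) - card (path a))"
      by (simp add: card_path_step[OF y(1)] Suc_diff_le)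
    show ?thesis
      unfolding * **
      using less.IH[OF base_less[OF y(1)] y(2)] not_in_path_base[OF y(1)]
      by (simp add: add.commute)
  qed simp
qed

end

text \<open>
  This is what the shape of the factor is made for: its square is a multiple of \<open>1 / (j + 1)\<close>, and
  the harmonic sum up to \<open>q \<le> r\<close> is at most \<open>ln r + 1\<close>, the other factor of the denominator.
\<close>

lemma sum_aux_step_factor_le:
  assumes "real q \<le> r"
  shows "(\<Sum>j<q. (aux_step_factor (ereal r) j)\<^sup>2) \<le> r"
proof (cases "q = 0")
  case False
  then have r: "r \<ge> 1" using assms by linarith
  then have pos: "ln r + 1 > 0" by (simp add: add_nonneg_pos)
  have "harm q - ln (real q) \<le> (harm 1 - ln (real 1) :: real)"
    using euler_mascheroni_sequence_decreasing[of 1 q] False by simp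
  then have "harm q \<le> ln (real q) + 1" by (simp add: harm_expand)
  also have "ln (real q) \<le> ln r"
    using assms False by simp
  finally have harm: "harm q \<le> ln r + 1" by simp
  have "(aux_step_factor (ereal r) j)\<^sup>2 = r / (ln r + 1) * inverse (of_nat (Suc j))" for j
  proof -
    have "0 \<le> r / ((real j + 1) * (ln r + 1))" using r pos by simp
    then have "(aux_step_factor (ereal r) j)\<^sup>2 = r / ((real j + 1) * (ln r + 1))"
      using r by (simp add: aux_step_factor_def)
    also have "\<dots> = r / (ln r + 1) * inverse (of_nat (Suc j))"
      by (simp add: divide_inverse ac_simps)
    finally show ?thesis .
  qed
  then have "(\<Sum>j<q. (aux_step_factor (ereal r) j)\<^sup>2) = r / (ln r + 1) * harm q"
    by (simp add: harm_altdef sum_distrib_left)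
  also have "\<dots> \<le> r / (ln r + 1) * (ln r + 1)"
    using harm r pos by (intro mult_left_mono) auto
  finally show ?thesis using pos by simp
qed (use assms in simp)

lemma aux_step_factor_antimono:
  assumes "r \<ge> 1" and "i \<le> j"
  shows "aux_step_factor (ereal r) j \<le> aux_step_factor (ereal r) i"
proof -
  have pos: "ln r + 1 > 0" using assms by (simp add: add_nonneg_pos)
  have "r / ((real j + 1) * (ln r + 1)) \<le> r / ((real i + 1) * (ln r + 1))"
  proof (rule divide_left_mono)
    show "(real i + 1) * (ln r + 1) \<le> (real j + 1) * (ln r + 1)"
      using assms(2) pos by (intro mult_right_mono) auto
  qed (use assms pos in simp_all)
  then show ?thesis
    using assms(1) by (simp add: aux_step_factor_def)
qed

context computation_tree
begin

text \<open>
  All that the convergence proof needs to know about the tree. If \<open>x p\<close> is the closest common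
  ancestor of \<open>x k\<close> and its gradient node, the steps shared by both paths cancel. By the inclusion of
  representations, each remaining step of the gradient node uses the same stochastic gradient as one
  of the main steps \<open>p, \<dots>, k - 1\<close>. Hence the difference is a combination of these main gradients, with
  coefficient \<open>-\<gamma>\<close> for an unpaired main step and \<open>s - \<gamma>\<close> for one that is paired with a side step of
  size \<open>s\<close>. As \<open>(s - \<gamma>)\<^sup>2 \<le> s\<^sup>2 + \<gamma>\<^sup>2\<close>, the main steps contribute at most \<open>r \<gamma>\<^sup>2\<close> to the sum of
  squares, and so do the side steps, by the harmonic sum above.
\<close>

proposition delayed_main_branch:
  fixes r \<gamma> :: real
  assumes x: "main_branch base x"
    and main: "\<And>i. step (x (Suc i)) = \<gamma>"
    and sub: "repr base grad sample w (grad (x (Suc k))) \<subseteq># repr base grad sample w (x k)"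
    and dist: "real (tree_dist base (x k) (grad (x (Suc k)))) \<le> r"
    and other: "\<And>n. n > 0 \<Longrightarrow> n \<notin> range x \<Longrightarrow>
      step n \<le> aux_step_factor (ereal r) (branch_dist base (base n) x) * \<gamma>"
  obtains p c where "p \<le> k" and "real (k - p) \<le> r" and "(\<Sum>i\<in>{p..<k}. (c i)\<^sup>2) \<le> 2 * r * \<gamma>\<^sup>2"
    and "\<And>\<omega>. w (x k) \<omega> - w (grad (x (Suc k))) \<omega> =
      (\<Sum>i\<in>{p..<k}. c i *\<^sub>R g (w (grad (x (Suc i))) \<omega>) (sample (x (Suc i)) \<omega>))"
proof -
  define y where "y = grad (x (Suc k))"
  define a where "a = closest_common_ancestor base (x k) y"
  define Q where "Q = path y - path a"
  define pr where "pr n = (w (grad n), sample n)" for n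
  define G where "G n \<omega> = g (w (grad n) \<omega>) (sample n \<omega>)" for n \<omega>
  define X where "X i = x (Suc i)" for i
  have anc_a: "ancestor base a (x k)" "ancestor base a y"
    by (simp_all add: a_def closest_common_ancestor(1,2))
  obtain p where p: "p \<le> k" "a = x p"
    using ancestor_of_main_branch[OF x anc_a(1)] .
  have "strict_mono x" by (rule strict_mono_main_branch[OF x])
  have X_pos: "X i > 0" for i by (simp add: X_def main_branch_simps(3)[OF x])
  have inj_X: "inj_on X A" for A
    using strict_mono_eq[OF \<open>strict_mono x\<close>] by (simp add: inj_on_def X_def)
  have step_X: "step (X i) = \<gamma>" for i by (simp add: X_def main)
  have card_a: "card (path a) = p"
    by (simp add: p(2) card_path_main_branch[OF x])
  have \<gamma>: "\<gamma> > 0"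
    using step_pos[OF X_pos[of 0]] main[of 0] by (simp add: X_def)

  have "edges_between base a (x k) \<le> tree_dist base (x k) y"
    "edges_between base a y \<le> tree_dist base (x k) y"
    by (simp_all add: tree_dist_def a_def)
  moreover have "card Q = card (path y) - card (path a)"
    unfolding Q_def by (rule card_Diff_subset) (simp_all add: path_mono anc_a)
  ultimately have kp: "real (k - p) \<le> r" and card_Q: "real (card Q) \<le> r"
    using dist edges_between_eq[OF anc_a(1)] edges_between_eq[OF anc_a(2)]
    by (simp_all add: y_def card_a card_path_main_branch[OF x])

  have contact: "ancestor base (x i) a" if "ancestor base (x i) y" for i
  proof (cases "i \<le> k")
    case True
    with that show ?thesis
      unfolding a_def by (intro closest_common_ancestor(3) ancestor_main_branch[OF x])
  next
    \<comment> \<open>A gradient is taken at an older node, so the main branch has left \<open>y\<close> behind after \<open>k\<close>.\<close>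
    case False
    then have "ancestor base (x (Suc k)) (x i)"
      by (intro ancestor_main_branch[OF x]) simp
    then have "x (Suc k) \<le> y"
      using that ancestor_le ancestor_trans by blast
    then show ?thesis
      using grad_less[OF X_pos[of k]] by (simp add: y_def X_def)
  qed
  have Q_side: "n > 0" "n \<notin> range x" "ancestor base n y" if "n \<in> Q" for n
    using that contact by (auto simp: Q_def path_def)

  have path_y: "path y = path a \<union> Q" "path a \<inter> Q = {}"
    using path_mono[OF anc_a(2)] by (auto simp: Q_def)
  have "{..<k} = {..<p} \<union> {p..<k}" using p(1) by auto
  then have path_x: "path (x k) = path a \<union> X ` {p..<k}"
    by (simp add: path_main_branch[OF x] p(2) image_Un X_def)
  have disj_x: "path a \<inter> X ` {p..<k} = {}"
    using strict_mono_eq[OF \<open>strict_mono x\<close>] by (auto simp: path_main_branch[OF x] p(2) X_def)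
  have repr_path: "repr base grad sample w n = image_mset pr (mset_set (path n))" for n
    by (simp add: repr_def path_def pr_def[abs_def])
  have "mset_set (path y) = mset_set (path a) + mset_set Q"
    unfolding path_y(1) by (rule mset_set_Union) (use path_y in \<open>auto simp: Q_def\<close>)
  moreover have "mset_set (path (x k)) = mset_set (path a) + mset_set (X ` {p..<k})"
    unfolding path_x by (rule mset_set_Union) (use disj_x in auto)
  moreover have "mset_set (X ` {p..<k}) = image_mset X (mset_set {p..<k})"
    by (simp add: image_mset_mset_set[OF inj_X])
  ultimately have "image_mset pr (mset_set Q) \<subseteq># image_mset (\<lambda>i. pr (X i)) (mset_set {p..<k})"
    using sub by (simp add: repr_path multiset.map_comp comp_def flip: y_def)
  then obtain \<phi> where \<phi>: "inj_on \<phi> Q" "\<phi> ` Q \<subseteq> {p..<k}" "\<And>n. n \<in> Q \<Longrightarrow> pr n = pr (X (\<phi> n))"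
    by (rule image_mset_mset_set_subset_matching[rotated 2]) (auto simp: Q_def)

  define s where "s i = (if i \<in> \<phi> ` Q then step (inv_into Q \<phi> i) else 0)" for i
  have s_\<phi>: "s (\<phi> n) = step n" if "n \<in> Q" for n
    using that \<phi>(1) by (simp add: s_def)
  have s_nonneg: "s i \<ge> 0" for i
    using Q_side(1)[OF inv_into_into[of i \<phi> Q]] by (auto simp: s_def intro!: less_imp_le step_pos)
  have reindex: "(\<Sum>n\<in>Q. h n) = (\<Sum>i\<in>{p..<k}. h' i)"
    if "\<And>n. n \<in> Q \<Longrightarrow> h n = h' (\<phi> n)" "\<And>i. s i = 0 \<Longrightarrow> h' i = 0" for h h' :: "nat \<Rightarrow> 'x :: comm_monoid_add"
  proof -
    have "(\<Sum>n\<in>Q. h n) = (\<Sum>i\<in>\<phi> ` Q. h' i)"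
      by (simp add: sum.reindex[OF \<phi>(1)] that(1))
    also have "\<dots> = (\<Sum>i\<in>{p..<k}. h' i)"
      using \<phi>(2) that(2) by (intro sum.mono_neutral_left) (auto simp: s_def)
    finally show ?thesis .
  qed

  show thesis
  proof (rule that[OF p(1) kp])
    fix \<omega>
    have "(\<Sum>n\<in>Q. step n *\<^sub>R G n \<omega>) = (\<Sum>i\<in>{p..<k}. s i *\<^sub>R G (X i) \<omega>)"
      using \<phi>(3) by (intro reindex) (simp_all add: s_\<phi> pr_def G_def)
    moreover have "w y \<omega> = w0 - (\<Sum>n\<in>path a. step n *\<^sub>R G n \<omega>) - (\<Sum>n\<in>Q. step n *\<^sub>R G n \<omega>)"
      unfolding node_path[of y] G_def[symmetric] path_y(1) using path_y(2)
      by (subst sum.union_disjoint) (auto simp: Q_def)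
    moreover have "w (x k) \<omega> = w0 - (\<Sum>n\<in>path a. step n *\<^sub>R G n \<omega>)
      - (\<Sum>i\<in>{p..<k}. \<gamma> *\<^sub>R G (X i) \<omega>)"
      unfolding node_path[of "x k"] G_def[symmetric] path_x using disj_x
      by (subst sum.union_disjoint) (simp_all add: sum.reindex[OF inj_X] step_X)
    ultimately have "w (x k) \<omega> - w y \<omega> = (\<Sum>i\<in>{p..<k}. (s i - \<gamma>) *\<^sub>R G (X i) \<omega>)"
      by (simp add: scaleR_left_diff_distrib sum_subtractf)
    then show "w (x k) \<omega> - w (grad (x (Suc k))) \<omega> =
      (\<Sum>i\<in>{p..<k}. (s i - \<gamma>) *\<^sub>R g (w (grad (x (Suc i))) \<omega>) (sample (x (Suc i)) \<omega>))"
      by (simp add: y_def G_def X_def)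
  next
    define j where "j n = card (path (base n)) - card (path a)" for n
    have "(s i - \<gamma>)\<^sup>2 \<le> (s i)\<^sup>2 + \<gamma>\<^sup>2" for i
      using s_nonneg[of i] \<gamma> by (simp add: power2_diff)
    then have "(\<Sum>i\<in>{p..<k}. (s i - \<gamma>)\<^sup>2) \<le> (\<Sum>i\<in>{p..<k}. (s i)\<^sup>2 + \<gamma>\<^sup>2)"
      by (intro sum_mono)
    also have "\<dots> = (\<Sum>n\<in>Q. (step n)\<^sup>2) + real (k - p) * \<gamma>\<^sup>2"
      by (simp add: sum.distrib reindex[of "\<lambda>n. (step n)\<^sup>2" "\<lambda>i. (s i)\<^sup>2"] s_\<phi>)
    also have "(\<Sum>n\<in>Q. (step n)\<^sup>2) \<le> (\<Sum>n\<in>Q. (aux_step_factor (ereal r) (j n))\<^sup>2 * \<gamma>\<^sup>2)"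
    proof (rule sum_mono)
      fix n assume n: "n \<in> Q"
      then have "card Q \<noteq> 0" by (auto simp: Q_def)
      then have r: "r \<ge> 1" using card_Q by linarith
      have "ancestor base (base n) y"
        using Q_side[OF n] ancestor_rec[of "base n" n] ancestor_trans[of "base n" n y] by simp
      then have "j n \<le> branch_dist base (base n) x"
        unfolding j_def using contact ancestor_trans by (intro branch_dist_ge[OF x]) blast
      then have "aux_step_factor (ereal r) (branch_dist base (base n) x) * \<gamma>
          \<le> aux_step_factor (ereal r) (j n) * \<gamma>"
        using \<gamma> by (intro mult_right_mono aux_step_factor_antimono r) simp_all
      with other[OF Q_side(1)[OF n] Q_side(2)[OF n]]
      have "step n \<le> aux_step_factor (ereal r) (j n) * \<gamma>" by simp
      then have "(step n)\<^sup>2 \<le> (aux_step_factor (ereal r) (j n) * \<gamma>)\<^sup>2"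
        using step_pos[OF Q_side(1)[OF n]] by (intro power_mono) simp_all
      then show "(step n)\<^sup>2 \<le> (aux_step_factor (ereal r) (j n))\<^sup>2 * \<gamma>\<^sup>2"
        by (simp add: power_mult_distrib)
    qed
    also have "\<dots> = (\<Sum>i<card (path y) - card (path a). (aux_step_factor (ereal r) i)\<^sup>2) * \<gamma>\<^sup>2"
      unfolding Q_def j_def sum_distrib_right[symmetric]
      by (simp add: sum_path_diff[OF anc_a(2), where h = "\<lambda>i. (aux_step_factor (ereal r) i)\<^sup>2"])
    also have "\<dots> \<le> r * \<gamma>\<^sup>2"
      using card_Q \<open>card Q = _\<close> by (intro mult_right_mono sum_aux_step_factor_le) simp_all
    also have "r * \<gamma>\<^sup>2 + real (k - p) * \<gamma>\<^sup>2 \<le> r * \<gamma>\<^sup>2 + r * \<gamma>\<^sup>2"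
      using kp by (intro add_left_mono mult_right_mono) simp_all
    finally show "(\<Sum>i\<in>{p..<k}. (s i - \<gamma>)\<^sup>2) \<le> 2 * r * \<gamma>\<^sup>2" by simp
  qed
qed

end

section \<open>Smooth functions, square-integrable vectors and independence\<close>

lemma lipschitz_gradient_upper_bound:
  fixes f :: "'a::real_inner \<Rightarrow> real"
  assumes gradient: "\<And>y. GDERIV f y :> f' y" and lip: "L-lipschitz_on UNIV f'"
  shows "f y \<le> f x + f' x \<bullet> (y - x) + L / 2 * (norm (y - x))\<^sup>2"
proof -
  define d where "d = y - x"
  define h where "h t = f (x + t *\<^sub>R d) - t * (f' x \<bullet> d) - L / 2 * t\<^sup>2 * (norm d)\<^sup>2" for t
  have "h 1 \<le> h 0"
  proof (rule DERIV_nonpos_imp_nonincreasing[where f = h])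
    fix t :: real assume "0 \<le> t"
    have f: "(f has_derivative (\<lambda>v. v \<bullet> f' (x + t *\<^sub>R d))) (at (x + t *\<^sub>R d))"
      using gradient by (simp add: gderiv_def)
    have line: "((\<lambda>t. x + t *\<^sub>R d) has_derivative (\<lambda>s. s *\<^sub>R d)) (at t)"
      by (auto intro!: derivative_eq_intros)
    have "((\<lambda>t. f (x + t *\<^sub>R d)) has_real_derivative d \<bullet> f' (x + t *\<^sub>R d)) (at t)"
      unfolding has_field_derivative_def
      using has_derivative_compose[OF line f] by (simp add: mult_commute_abs)
    then have "(h has_real_derivative
        d \<bullet> f' (x + t *\<^sub>R d) - f' x \<bullet> d - L * t * (norm d)\<^sup>2) (at t)"
      unfolding h_def by (auto intro!: derivative_eq_intros)
    moreover have "d \<bullet> f' (x + t *\<^sub>R d) - f' x \<bullet> d \<le> L * t * (norm d)\<^sup>2"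
    proof -
      have "d \<bullet> f' (x + t *\<^sub>R d) - f' x \<bullet> d = d \<bullet> (f' (x + t *\<^sub>R d) - f' x)"
        by (simp add: inner_diff_right inner_commute)
      also have "\<dots> \<le> norm d * norm (f' (x + t *\<^sub>R d) - f' x)"
        by (rule norm_cauchy_schwarz)
      also have "\<dots> \<le> norm d * (L * norm (t *\<^sub>R d))"
        using lipschitz_onD[OF lip, of "x + t *\<^sub>R d" x]
        by (intro mult_left_mono) (simp_all add: dist_norm)
      also have "\<dots> = L * t * (norm d)\<^sup>2"
        using \<open>0 \<le> t\<close> by (simp add: power2_eq_square)
      finally show ?thesis .
    qed
    ultimately show "\<exists>y. (h has_real_derivative y) (at t) \<and> y \<le> 0" by force
  qed simp
  then show ?thesis by (simp add: h_def d_def)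
qed

definition sq_integrable :: "'w measure \<Rightarrow> ('w \<Rightarrow> 'a::euclidean_space) \<Rightarrow> bool" where
  "sq_integrable M U \<longleftrightarrow> U \<in> borel_measurable M \<and> integrable M (\<lambda>\<omega>. (norm (U \<omega>))\<^sup>2)"

lemma sq_integrable_measurable: "sq_integrable M U \<Longrightarrow> U \<in> borel_measurable M"
  by (simp add: sq_integrable_def)

lemma sq_integrable_norm: "sq_integrable M U \<Longrightarrow> integrable M (\<lambda>\<omega>. (norm (U \<omega>))\<^sup>2)"
  by (simp add: sq_integrable_def)

lemma sq_integrable_mono:
  assumes "sq_integrable M V" and "U \<in> borel_measurable M" and "\<And>\<omega>. norm (U \<omega>) \<le> norm (V \<omega>)"
  shows "sq_integrable M U"
  unfolding sq_integrable_def
proof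
  show "integrable M (\<lambda>\<omega>. (norm (U \<omega>))\<^sup>2)"
    by (rule Bochner_Integration.integrable_bound[OF sq_integrable_norm[OF assms(1)]])
      (use assms(2,3) in \<open>auto simp: power_mono\<close>)
qed fact

lemma sq_integrable_scaleR [intro]:
  "sq_integrable M U \<Longrightarrow> sq_integrable M (\<lambda>\<omega>. (a::real) *\<^sub>R U \<omega>)"
  by (auto simp: sq_integrable_def power_mult_distrib)

lemma norm_add_sq_le: "(norm (a + b :: 'a::real_inner))\<^sup>2 \<le> 2 * (norm a)\<^sup>2 + 2 * (norm b)\<^sup>2"
proof -
  have "0 \<le> (norm (a - b))\<^sup>2" by simp
  then show ?thesis
    unfolding power2_norm_eq_inner
    by (simp add: inner_add_left inner_add_right inner_diff_left inner_diff_right inner_commute)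
qed

lemma sq_integrable_add [intro]:
  assumes "sq_integrable M U" and "sq_integrable M V"
  shows "sq_integrable M (\<lambda>\<omega>. U \<omega> + V \<omega>)"
  unfolding sq_integrable_def
proof
  note assms[THEN sq_integrable_measurable, measurable]
  show "(\<lambda>\<omega>. U \<omega> + V \<omega>) \<in> borel_measurable M" by measurable
  have "integrable M (\<lambda>\<omega>. 2 * (norm (U \<omega>))\<^sup>2 + 2 * (norm (V \<omega>))\<^sup>2)"
    using assms by (auto simp: sq_integrable_def)
  then show "integrable M (\<lambda>\<omega>. (norm (U \<omega> + V \<omega>))\<^sup>2)"
    by (rule Bochner_Integration.integrable_bound) (use norm_add_sq_le in auto)
qed

lemma sq_integrable_diff [intro]:
  assumes "sq_integrable M U" and "sq_integrable M V"
  shows "sq_integrable M (\<lambda>\<omega>. U \<omega> - V \<omega>)"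
  using sq_integrable_add[OF assms(1) sq_integrable_scaleR[OF assms(2), of "-1"]] by simp

lemma (in finite_measure) sq_integrable_const [intro]: "sq_integrable M (\<lambda>\<omega>. a)"
  by (simp add: sq_integrable_def)

lemma (in finite_measure) sq_integrable_sum [intro]:
  "(\<And>i. i \<in> I \<Longrightarrow> sq_integrable M (U i)) \<Longrightarrow> sq_integrable M (\<lambda>\<omega>. \<Sum>i\<in>I. U i \<omega>)"
  by (induction I rule: infinite_finite_induct) auto

lemma sq_integrable_inner [intro]:
  fixes U V :: "'w \<Rightarrow> 'a::euclidean_space"
  assumes "sq_integrable M U" and "sq_integrable M V"
  shows "integrable M (\<lambda>\<omega>. U \<omega> \<bullet> V \<omega>)"
proof -
  note assms[THEN sq_integrable_measurable, measurable]
  have "integrable M (\<lambda>\<omega>. (norm (U \<omega>))\<^sup>2 + (norm (V \<omega>))\<^sup>2)"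
    using assms by (auto simp: sq_integrable_def)
  then show ?thesis
  proof (rule Bochner_Integration.integrable_bound)
    have "\<bar>a \<bullet> b\<bar> \<le> (norm a)\<^sup>2 + (norm b)\<^sup>2" for a b :: 'a
    proof -
      have "\<bar>a \<bullet> b\<bar> \<le> norm a * norm b" by (rule Cauchy_Schwarz_ineq2)
      also have "\<dots> \<le> 2 * norm a * norm b" by simp
      also have "\<dots> \<le> (norm a)\<^sup>2 + (norm b)\<^sup>2" by (rule sum_squares_bound)
      finally show ?thesis .
    qed
    then show "AE \<omega> in M. norm (U \<omega> \<bullet> V \<omega>) \<le> norm ((norm (U \<omega>))\<^sup>2 + (norm (V \<omega>))\<^sup>2)"
      by simp
  qed measurable
qed

text \<open>
  A sample is independent of everything computed before it, which is best expressed by a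
  \<open>\<sigma>\<close>-algebra \<open>F\<close> of past events: the joint law of the sample and any variable of the past is a
  product measure, so expectations can be taken over the sample first.
\<close>

lemma (in prob_space) distr_pair_indep_subalgebra:
  assumes sub: "subalgebra M F"
    and indep: "indep_set (sets (vimage_algebra (space M) X D)) (sets F)"
    and V: "V \<in> F \<rightarrow>\<^sub>M N" and X: "X \<in> M \<rightarrow>\<^sub>M D"
  shows "distr M (N \<Otimes>\<^sub>M D) (\<lambda>\<omega>. (V \<omega>, X \<omega>)) = distr M N V \<Otimes>\<^sub>M distr M D X"
proof (rule sym, rule pair_measure_eqI)
  note [measurable] = measurable_from_subalg[OF sub V] X
  show "sigma_finite_measure (distr M N V)" "sigma_finite_measure (distr M D X)"
    using prob_space_distr prob_space_imp_sigma_finite by measurable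
  fix A B assume A: "A \<in> sets (distr M N V)" and B: "B \<in> sets (distr M D X)"
  then have [measurable]: "A \<in> sets N" "B \<in> sets D" by simp_all
  have "V -` A \<inter> space M \<in> sets F"
    using measurable_sets[OF V \<open>A \<in> sets N\<close>] sub by (simp add: subalgebra_def)
  moreover have "X -` B \<inter> space M \<in> sets (vimage_algebra (space M) X D)"
    by (rule in_vimage_algebra) simp
  ultimately have "prob ((X -` B \<inter> space M) \<inter> (V -` A \<inter> space M))
      = prob (X -` B \<inter> space M) * prob (V -` A \<inter> space M)"
    by (intro indep_setD[OF indep])
  moreover have "(\<lambda>\<omega>. (V \<omega>, X \<omega>)) -` (A \<times> B) \<inter> space M
      = (X -` B \<inter> space M) \<inter> (V -` A \<inter> space M)"
    by auto
  ultimately show "emeasure (distr M N V) A * emeasure (distr M D X) B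
      = emeasure (distr M (N \<Otimes>\<^sub>M D) (\<lambda>\<omega>. (V \<omega>, X \<omega>))) (A \<times> B)"
    by (simp add: emeasure_distr emeasure_eq_measure ennreal_mult mult.commute)
qed simp

section \<open>Finite sums and constants\<close>

text \<open>
  An index \<open>i\<close> belongs to the window of \<open>k\<close> only if \<open>i < k \<le> i + r\<close>, hence to at most \<open>r\<close> windows.
\<close>

lemma sum_window_le:
  fixes e :: "nat \<Rightarrow> real"
  assumes e: "\<And>i. e i \<ge> 0" and p: "\<And>k. real (k - p k) \<le> r"
  shows "(\<Sum>k<K. \<Sum>i\<in>{p k..<k}. e i) \<le> r * (\<Sum>i<K. e i)"
proof -
  have "(\<Sum>k<K. \<Sum>i\<in>{p k..<k}. e i) = (\<Sum>k<K. \<Sum>i<K. if p k \<le> i \<and> i < k then e i else 0)"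
    by (intro sum.cong refl sum.mono_neutral_cong_left) auto
  also have "\<dots> = (\<Sum>i<K. \<Sum>k<K. if p k \<le> i \<and> i < k then e i else 0)"
    by (rule sum.swap)
  also have "\<dots> \<le> (\<Sum>i<K. r * e i)"
  proof (rule sum_mono)
    fix i
    define A where "A = {k. k < K \<and> p k \<le> i \<and> i < k}"
    have "A \<subseteq> {i<..i + nat \<lfloor>r\<rfloor>}"
    proof
      fix k assume "k \<in> A"
      moreover have "k - p k \<le> nat \<lfloor>r\<rfloor>" using p[of k] by (simp add: le_nat_floor)
      ultimately show "k \<in> {i<..i + nat \<lfloor>r\<rfloor>}" by (auto simp: A_def)
    qed
    then have "card A \<le> nat \<lfloor>r\<rfloor>" using card_mono[of "{i<..i + nat \<lfloor>r\<rfloor>}" A] by simp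
    moreover have "r \<ge> 0" using p[of 0] by simp
    ultimately have "real (card A) \<le> r" by linarith
    then have "real (card A) * e i \<le> r * e i" by (rule mult_right_mono) (rule e)
    moreover have "(\<Sum>k<K. if p k \<le> i \<and> i < k then e i else 0) = (\<Sum>k\<in>A. e i)"
      by (intro sum.mono_neutral_cong_right) (auto simp: A_def)
    ultimately show "(\<Sum>k<K. if p k \<le> i \<and> i < k then e i else 0) \<le> r * e i" by simp
  qed
  finally show ?thesis by (simp add: sum_distrib_left)
qed

text \<open>
  The final computation, freed of its units: \<open>\<tau> = L \<gamma>\<close>, \<open>\<rho> = r L \<gamma>\<close>, \<open>\<nu> = \<sigma>\<^sup>2 L \<gamma> / \<epsilon>\<close>, \<open>h = \<Delta> / \<gamma>\<close>
  and \<open>B = K \<epsilon>\<close>, while \<open>SX\<close>, \<open>SZ\<close> and \<open>SD\<close> are the sums of the mean squares of the gradients at \<open>x k\<close>,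
  at \<open>z k\<close>, and of their differences. In most cases the positive multiple of \<open>SZ\<close> on the left can be
  discarded, and \<open>budget\<close> pays for what remains. The exception is a step size dictated by the noise
  with \<open>\<rho>\<close> and \<open>\<tau>\<close> tiny: then \<open>2 * h\<close> alone may amount to \<open>B\<close>. But in this regime the gradients at \<open>z k\<close>
  and \<open>x k\<close> nearly agree, so \<open>SZ\<close> is kept and converted into a further multiple of \<open>SX\<close> by \<open>triangle\<close>.
  The threshold \<open>1/20\<close> is a convenient place to separate the two regimes.
\<close>

lemma scaled_rate:
  fixes \<tau> \<rho> \<nu> h B SX SZ SD :: real
  assumes nonneg: "0 \<le> \<tau>" "0 \<le> \<rho>" "0 \<le> \<nu>" "0 \<le> h" "0 \<le> B" "0 \<le> SZ"
    and bounds: "\<tau> \<le> 1/2" "\<rho> \<le> 1/4" "\<nu> \<le> 1/8"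
    and tight: "\<tau> = 1/2 \<or> \<rho> = 1/4 \<or> \<nu> = 1/8"
    and budget: "h * (8 * (\<rho> + \<tau>) + 16 * \<nu>) \<le> B"
    and descent: "SX + SZ - SD \<le> 2 * h + \<tau> * SZ + \<nu> * B"
    and delay: "SD \<le> 4 * \<rho>\<^sup>2 * SZ + 4 * \<rho> * \<nu> * B"
    and triangle: "SX \<le> 2 * SZ + 2 * SD"
  shows "SX \<le> B"
proof -
  have \<nu>B: "\<nu> * B \<le> B / 8" using mult_right_mono[OF bounds(3) nonneg(5)] by simp
  have \<rho>\<nu>B: "4 * \<rho> * \<nu> * B \<le> \<rho> * B / 2"
    using mult_left_mono[OF \<nu>B nonneg(2)] by simp
  have \<rho>B: "\<rho> * B \<le> B / 4" using mult_right_mono[OF bounds(2) nonneg(5)] by simp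
  have h\<rho>: "0 \<le> h * \<rho>" "0 \<le> h * \<tau>" "0 \<le> h * \<nu>" using nonneg by simp_all
  have sq: "\<rho>\<^sup>2 \<le> 1/16" using power_mono[OF bounds(2) nonneg(2), of 2] by (simp add: power2_eq_square)
  have "4 * \<rho>\<^sup>2 * SZ \<le> 1/4 * SZ" using sq nonneg(6) by (intro mult_right_mono) auto
  moreover have "\<tau> * SZ \<le> 1/2 * SZ" using bounds(1) nonneg(6) by (intro mult_right_mono) auto
  ultimately have drop: "SX \<le> 2 * h + \<nu> * B + 4 * \<rho> * \<nu> * B"
    using descent delay nonneg(6) by linarith
  have budget': "8 * (h * \<rho>) + 8 * (h * \<tau>) + 16 * (h * \<nu>) \<le> B"
    using budget by (simp add: algebra_simps)
  from tight consider "\<tau> = 1/2" | "\<rho> = 1/4" | "\<nu> = 1/8" "\<rho> + \<tau> \<ge> 1/20" | "\<nu> = 1/8" "\<rho> + \<tau> < 1/20"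
    by linarith
  then show ?thesis
  proof cases
    case 1
    then have "h * \<tau> = h / 2" by simp
    then have "4 * h \<le> B" using budget' h\<rho> by linarith
    then show ?thesis using drop \<nu>B \<rho>\<nu>B \<rho>B nonneg(5) by linarith
  next
    case 2
    then have "h * \<rho> = h / 4" by simp
    then have "2 * h + 16 * (h * \<nu>) \<le> B" using budget' h\<rho> by linarith
    then have "(2 * h + 16 * (h * \<nu>)) * (1 - 2 * \<nu>) \<le> B * (1 - 2 * \<nu>)"
      using bounds(3) by (intro mult_right_mono) auto
    moreover have "32 * (h * \<nu>) * \<nu> \<le> 32 * (h * \<nu>) * (1/8)"
      using h\<rho>(3) bounds(3) by (intro mult_left_mono) auto
    ultimately have "2 * h + 2 * (\<nu> * B) \<le> B"
      using h\<rho>(3) by (simp add: algebra_simps)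
    moreover have "4 * \<rho> * \<nu> * B = \<nu> * B" using 2 by simp
    ultimately show ?thesis using drop by linarith
  next
    case 3
    have ht: "2 * h + 8 * (h * (\<rho> + \<tau>)) \<le> B" using budget' 3(1) by (simp add: algebra_simps)
    have *: "2 * h + 8 * (h * a) \<le> B" if "a \<le> \<rho> + \<tau>" for a
      using ht mult_left_mono[OF that nonneg(4)] by linarith
    have \<rho>': "\<rho> * B \<le> a * B" if "\<rho> \<le> a" for a
      using that nonneg(5) by (rule mult_right_mono)
    consider "\<rho> \<le> 8/100" | "8/100 \<le> \<rho>" "\<rho> \<le> 1/10" | "1/10 \<le> \<rho>" by linarith
    then show ?thesis
    proof cases
      case 1
      moreover have "2 * h + 8 * (h * (1/20)) \<le> B" using 3(2) by (rule *)
      ultimately show ?thesis using drop \<nu>B \<rho>\<nu>B \<rho>'[of "8/100"] nonneg(5) by linarith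
    next
      case 2
      then have "2 * h + 8 * (h * (8/100)) \<le> B" using nonneg(1) by (intro *) simp
      then show ?thesis using drop \<nu>B \<rho>\<nu>B \<rho>'[OF 2(2)] nonneg(5) by linarith
    next
      case 3
      then have "2 * h + 8 * (h * (1/10)) \<le> B" using nonneg(1) by (intro *) simp
      then show ?thesis using drop \<nu>B \<rho>\<nu>B \<rho>B nonneg(5) by linarith
    qed
  next
    case 4
    then have small: "\<rho> \<le> 1/20" "\<tau> \<le> 1/20" using nonneg by auto
    have "\<rho>\<^sup>2 \<le> 1/400" using power_mono[OF small(1) nonneg(2), of 2] by (simp add: power2_eq_square)
    then have "4 * \<rho>\<^sup>2 * SZ \<le> 1/100 * SZ" using nonneg(6) by (intro mult_right_mono) auto
    moreover have "\<tau> * SZ \<le> 1/20 * SZ" using small nonneg(6) by (intro mult_right_mono) auto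
    moreover have "\<rho> * B \<le> 1/20 * B" using small nonneg(5) by (intro mult_right_mono) auto
    moreover have "h * \<nu> = h / 8" using 4(1) by simp
    then have "2 * h \<le> B" using budget' h\<rho> by linarith
    ultimately show ?thesis
      using descent delay triangle \<nu>B \<rho>\<nu>B nonneg(5,6) by linarith
  qed
qed

section \<open>Gradient descent with delayed stochastic gradients\<close>

text \<open>
  Stochastic gradient descent in which step \<open>k\<close> uses a gradient taken at \<open>Z k\<close> instead of \<open>X k\<close>. The
  tree survives only in the assumption \<open>delay\<close>; \<open>F k\<close> is the past of the sample \<open>\<xi> k\<close>.
\<close>

locale delayed_sgd = prob_space M
  for M :: "'w measure" and D :: "'s measure"
    and f :: "'a::euclidean_space \<Rightarrow> real" and f' :: "'a \<Rightarrow> 'a" and g :: "'a \<Rightarrow> 's \<Rightarrow> 'a"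
    and L \<sigma> \<gamma> r \<Delta> :: real and w0 :: 'a
    and X Z :: "nat \<Rightarrow> 'w \<Rightarrow> 'a" and \<xi> :: "nat \<Rightarrow> 'w \<Rightarrow> 's" and F :: "nat \<Rightarrow> 'w measure" +
  assumes D: "prob_space D"
    and gradient: "\<And>y. GDERIV f y :> f' y"
    and smooth: "L-lipschitz_on UNIV f'"
    and gap: "\<And>y. f w0 - f y \<le> \<Delta>"
    and g_measurable: "(\<lambda>(y, s). g y s) \<in> borel_measurable (borel \<Otimes>\<^sub>M D)"
    and unbiased: "\<And>y. has_bochner_integral D (g y) (f' y)"
    and noise_var: "\<And>y. (\<integral>\<^sup>+ s. ennreal ((norm (g y s - f' y))\<^sup>2) \<partial>D) \<le> ennreal (\<sigma>\<^sup>2)"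
    and gamma_pos: "\<gamma> > 0"
    and X_0: "X 0 = (\<lambda>\<omega>. w0)"
    and X_Suc: "\<And>k. X (Suc k) = (\<lambda>\<omega>. X k \<omega> - \<gamma> *\<^sub>R g (Z k \<omega>) (\<xi> k \<omega>))"
    and delay: "\<And>k. \<exists>p\<le>k. \<exists>c. real (k - p) \<le> r \<and> (\<Sum>i\<in>{p..<k}. (c i)\<^sup>2) \<le> 2 * r * \<gamma>\<^sup>2 \<and>
      (\<forall>\<omega>. X k \<omega> - Z k \<omega> = (\<Sum>i\<in>{p..<k}. c i *\<^sub>R g (Z i \<omega>) (\<xi> i \<omega>)))"
    and subalgebra: "\<And>k. subalgebra M (F k)"
    and Z_past: "\<And>i k. i \<le> k \<Longrightarrow> Z i \<in> borel_measurable (F k)"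
    and \<xi>_past: "\<And>i k. i < k \<Longrightarrow> \<xi> i \<in> F k \<rightarrow>\<^sub>M D"
    and \<xi>_distr: "\<And>k. distr M D (\<xi> k) = D"
    and indep: "\<And>k. indep_set (sets (vimage_algebra (space M) (\<xi> k) D)) (sets (F k))"
begin

definition G :: "nat \<Rightarrow> 'w \<Rightarrow> 'a" where "G k \<omega> = g (Z k \<omega>) (\<xi> k \<omega>)"
definition H :: "nat \<Rightarrow> 'w \<Rightarrow> 'a" where "H k \<omega> = f' (Z k \<omega>)"
definition noise :: "nat \<Rightarrow> 'w \<Rightarrow> 'a" where "noise k \<omega> = G k \<omega> - H k \<omega>"
definition P :: "nat \<Rightarrow> 'w \<Rightarrow> 'a" where "P k \<omega> = f' (X k \<omega>)"

lemma L_nonneg: "L \<ge> 0"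
  using lipschitz_on_nonneg[OF smooth] .

lemma f'_lipschitz: "norm (f' y - f' z) \<le> L * norm (y - z)"
  using lipschitz_onD[OF smooth, of y z] by (simp add: dist_norm)

lemma f'_measurable [measurable]: "f' \<in> borel_measurable borel"
  by (intro borel_measurable_continuous_onI lipschitz_on_continuous_on[OF smooth])

lemma g_measurable_comp:
  assumes "V \<in> N \<rightarrow>\<^sub>M borel" and "Y \<in> N \<rightarrow>\<^sub>M D"
  shows "(\<lambda>\<omega>. g (V \<omega>) (Y \<omega>)) \<in> borel_measurable N"
  using measurable_compose[OF measurable_Pair[OF assms] g_measurable] by simp

lemma \<xi>_measurable [measurable]: "\<xi> k \<in> M \<rightarrow>\<^sub>M D"
  by (rule measurable_from_subalg[OF subalgebra \<xi>_past[of k "Suc k"]]) simp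

lemma Z_measurable [measurable]: "Z k \<in> borel_measurable M"
  by (rule measurable_from_subalg[OF subalgebra Z_past[of k k]]) simp

lemma G_past: "i < k \<Longrightarrow> G i \<in> borel_measurable (F k)"
  unfolding G_def[abs_def] by (intro g_measurable_comp Z_past \<xi>_past) auto

lemma H_past: "i \<le> k \<Longrightarrow> H i \<in> borel_measurable (F k)"
  unfolding H_def[abs_def] by (intro measurable_compose[OF Z_past]) auto

lemma noise_past: "i < k \<Longrightarrow> noise i \<in> borel_measurable (F k)"
  unfolding noise_def[abs_def] using G_past[of i k] H_past[of i k] by simp

lemma X_sum: "X k \<omega> = w0 - (\<Sum>i<k. \<gamma> *\<^sub>R G i \<omega>)"
  by (induction k) (simp_all add: X_0 X_Suc G_def)

lemma P_past: "P k \<in> borel_measurable (F k)"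
proof -
  have "X k \<in> borel_measurable (F k)"
    unfolding X_sum[abs_def] using G_past
    by (intro borel_measurable_diff borel_measurable_sum borel_measurable_scaleR) auto
  then show ?thesis unfolding P_def[abs_def] by simp
qed

lemma G_measurable [measurable]: "G k \<in> borel_measurable M"
  unfolding G_def[abs_def] by (intro g_measurable_comp) auto

lemma H_measurable [measurable]: "H k \<in> borel_measurable M"
  unfolding H_def[abs_def] by measurable

lemma noise_measurable [measurable]: "noise k \<in> borel_measurable M"
  unfolding noise_def[abs_def] by measurable

lemma joint_distr:
  assumes "V \<in> F k \<rightarrow>\<^sub>M N"
  shows "distr M (N \<Otimes>\<^sub>M D) (\<lambda>\<omega>. (V \<omega>, \<xi> k \<omega>)) = distr M N V \<Otimes>\<^sub>M D"
  using distr_pair_indep_subalgebra[OF subalgebra indep assms \<xi>_measurable] by (simp add: \<xi>_distr)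

lemma sq_integrable_noise:
  shows "sq_integrable M (noise k)" and "expectation (\<lambda>\<omega>. (norm (noise k \<omega>))\<^sup>2) \<le> \<sigma>\<^sup>2"
proof -
  interpret D: prob_space D by (rule D)
  interpret Z: prob_space "distr M borel (Z k)" by (rule prob_space_distr) measurable
  define \<phi> where "\<phi> p = ennreal ((norm (g (fst p) (snd p) - f' (fst p)))\<^sup>2)" for p :: "'a \<times> 's"
  have [measurable]: "(\<lambda>p. g (fst p) (snd p)) \<in> borel_measurable (borel \<Otimes>\<^sub>M D)"
    by (intro g_measurable_comp) auto
  have \<phi>: "\<phi> \<in> borel_measurable (borel \<Otimes>\<^sub>M D)" unfolding \<phi>_def[abs_def] by measurable
  have "(\<integral>\<^sup>+ \<omega>. ennreal ((norm (noise k \<omega>))\<^sup>2) \<partial>M) = (\<integral>\<^sup>+ \<omega>. \<phi> (Z k \<omega>, \<xi> k \<omega>) \<partial>M)"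
    by (simp add: \<phi>_def noise_def G_def H_def)
  also have "\<dots> = (\<integral>\<^sup>+ p. \<phi> p \<partial>distr M (borel \<Otimes>\<^sub>M D) (\<lambda>\<omega>. (Z k \<omega>, \<xi> k \<omega>)))"
    using \<phi> by (subst nn_integral_distr) auto
  also have "\<dots> = (\<integral>\<^sup>+ p. \<phi> p \<partial>(distr M borel (Z k) \<Otimes>\<^sub>M D))"
    using joint_distr[OF Z_past[of k k]] by simp
  also have "\<dots> = (\<integral>\<^sup>+ z. \<integral>\<^sup>+ s. \<phi> (z, s) \<partial>D \<partial>distr M borel (Z k))"
    using \<phi> by (intro D.nn_integral_fst[symmetric]) simp
  also have "\<dots> \<le> (\<integral>\<^sup>+ z. ennreal (\<sigma>\<^sup>2) \<partial>distr M borel (Z k))"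
    using noise_var by (intro nn_integral_mono) (simp add: \<phi>_def)
  also have "\<dots> = ennreal (\<sigma>\<^sup>2)"
    using Z.emeasure_space_1 by simp
  finally have le: "(\<integral>\<^sup>+ \<omega>. ennreal ((norm (noise k \<omega>))\<^sup>2) \<partial>M) \<le> ennreal (\<sigma>\<^sup>2)" .
  then have int: "integrable M (\<lambda>\<omega>. (norm (noise k \<omega>))\<^sup>2)"
    by (intro integrableI_nonneg) (auto simp: le_less_trans[OF le])
  then show "sq_integrable M (noise k)" by (simp add: sq_integrable_def)
  from le int show "expectation (\<lambda>\<omega>. (norm (noise k \<omega>))\<^sup>2) \<le> \<sigma>\<^sup>2"
    by (simp add: nn_integral_eq_integral)
qed

lemma noise_orthogonal:
  assumes past: "U \<in> borel_measurable (F k)" and U: "sq_integrable M U"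
  shows "expectation (\<lambda>\<omega>. U \<omega> \<bullet> noise k \<omega>) = 0"
proof -
  define V where "V \<omega> = (U \<omega>, Z k \<omega>)" for \<omega>
  have V_past: "V \<in> F k \<rightarrow>\<^sub>M borel \<Otimes>\<^sub>M borel"
    unfolding V_def[abs_def] using past Z_past by (intro measurable_Pair) auto
  have V [measurable]: "V \<in> M \<rightarrow>\<^sub>M borel \<Otimes>\<^sub>M borel"
    by (rule measurable_from_subalg[OF subalgebra V_past])
  interpret D: prob_space D by (rule D)
  interpret V: prob_space "distr M (borel \<Otimes>\<^sub>M borel) V" by (rule prob_space_distr) (rule V)
  interpret VD: pair_sigma_finite "distr M (borel \<Otimes>\<^sub>M borel) V" D ..
  define \<psi> where "\<psi> p = fst (fst p) \<bullet> (g (snd (fst p)) (snd p) - f' (snd (fst p)))"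
    for p :: "('a \<times> 'a) \<times> 's"
  have [measurable]: "(\<lambda>p. g (snd (fst p)) (snd p)) \<in> borel_measurable ((borel \<Otimes>\<^sub>M borel) \<Otimes>\<^sub>M D)"
    by (intro g_measurable_comp) auto
  have \<psi>: "\<psi> \<in> borel_measurable ((borel \<Otimes>\<^sub>M borel) \<Otimes>\<^sub>M D)"
    unfolding \<psi>_def[abs_def] by measurable
  have eq: "(\<lambda>\<omega>. U \<omega> \<bullet> noise k \<omega>) = (\<lambda>\<omega>. \<psi> (V \<omega>, \<xi> k \<omega>))"
    by (simp add: \<psi>_def V_def noise_def G_def H_def)
  have pair: "(\<lambda>\<omega>. (V \<omega>, \<xi> k \<omega>)) \<in> M \<rightarrow>\<^sub>M (borel \<Otimes>\<^sub>M borel) \<Otimes>\<^sub>M D" by measurable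
  have "integrable M (\<lambda>\<omega>. \<psi> (V \<omega>, \<xi> k \<omega>))"
    using sq_integrable_inner[OF U sq_integrable_noise(1)[of k]] unfolding eq .
  then have int: "integrable (distr M (borel \<Otimes>\<^sub>M borel) V \<Otimes>\<^sub>M D) \<psi>"
    unfolding joint_distr[OF V_past, symmetric] using \<psi> pair by (simp add: integrable_distr_eq)
  have zero: "(\<integral>s. \<psi> (v, s) \<partial>D) = 0" for v
  proof -
    have "has_bochner_integral D (\<lambda>s. g (snd v) s - f' (snd v)) (f' (snd v) - f' (snd v))"
      using has_bochner_integral_diff[OF unbiased[of "snd v"]
          has_bochner_integral_integrable[OF D.integrable_const[of "f' (snd v)"]]]
      by (simp add: D.prob_space)
    then have "has_bochner_integral D (\<lambda>s. fst v \<bullet> (g (snd v) s - f' (snd v))) (fst v \<bullet> 0)"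
      by (intro has_bochner_integral_inner_right) auto
    then show ?thesis
      using has_bochner_integral_integral_eq by (fastforce simp: \<psi>_def)
  qed
  have "expectation (\<lambda>\<omega>. U \<omega> \<bullet> noise k \<omega>)
      = (\<integral>p. \<psi> p \<partial>distr M ((borel \<Otimes>\<^sub>M borel) \<Otimes>\<^sub>M D) (\<lambda>\<omega>. (V \<omega>, \<xi> k \<omega>)))"
    unfolding eq using \<psi> pair by (intro integral_distr[symmetric])
  also have "\<dots> = (\<integral>v. (\<integral>s. \<psi> (v, s) \<partial>D) \<partial>distr M (borel \<Otimes>\<^sub>M borel) V)"
    unfolding joint_distr[OF V_past] using int by (rule VD.integral_fst'[symmetric])
  finally show ?thesis by (simp add: zero)
qed

lemma sq_integrable_f':
  assumes "sq_integrable M Y"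
  shows "sq_integrable M (\<lambda>\<omega>. f' (Y \<omega>))"
proof -
  note sq_integrable_measurable[OF assms, measurable]
  have "sq_integrable M (\<lambda>\<omega>. f' (Y \<omega>) - f' 0)"
    by (rule sq_integrable_mono[OF sq_integrable_scaleR[OF assms, of L]])
      (use f'_lipschitz[of _ 0] L_nonneg in auto)
  from sq_integrable_add[OF this sq_integrable_const[of "f' 0"]] show ?thesis by simp
qed

text \<open>
  The induction can only run over the stochastic gradients: the iterates are sums of earlier ones,
  and the new one is the gradient at an iterate plus noise of bounded variance.
\<close>

lemma sq_integrable_iterates:
  shows "sq_integrable M (G k)" and "sq_integrable M (H k)"
    and "sq_integrable M (P k)" and "sq_integrable M (\<lambda>\<omega>. X k \<omega> - Z k \<omega>)"
proof -
  have step: "sq_integrable M (G k) \<and> sq_integrable M (H k) \<and> sq_integrable M (P k)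
      \<and> sq_integrable M (\<lambda>\<omega>. X k \<omega> - Z k \<omega>)"
    if G: "\<And>i. i < k \<Longrightarrow> sq_integrable M (G i)" for k
  proof -
    have X: "sq_integrable M (X k)"
      unfolding X_sum[abs_def] using G
      by (intro sq_integrable_diff sq_integrable_const sq_integrable_sum sq_integrable_scaleR) auto
    obtain p c where "\<And>\<omega>. X k \<omega> - Z k \<omega> = (\<Sum>i\<in>{p..<k}. c i *\<^sub>R g (Z i \<omega>) (\<xi> i \<omega>))"
      using delay[of k] by blast
    then have "(\<lambda>\<omega>. X k \<omega> - Z k \<omega>) = (\<lambda>\<omega>. \<Sum>i\<in>{p..<k}. c i *\<^sub>R G i \<omega>)"
      by (simp add: G_def)
    then have XZ: "sq_integrable M (\<lambda>\<omega>. X k \<omega> - Z k \<omega>)"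
      using G by (auto intro!: sq_integrable_sum sq_integrable_scaleR)
    from sq_integrable_diff[OF X XZ] have Z: "sq_integrable M (Z k)" by simp
    have H: "sq_integrable M (H k)" and P: "sq_integrable M (P k)"
      unfolding H_def[abs_def] P_def[abs_def] by (intro sq_integrable_f' Z X)+
    from sq_integrable_add[OF H sq_integrable_noise(1)[of k]]
    have "sq_integrable M (G k)" by (simp add: noise_def)
    with H P XZ show ?thesis by blast
  qed
  have "sq_integrable M (G k)" for k
    by (induction k rule: less_induct) (use step in blast)
  with step show "sq_integrable M (G k)" "sq_integrable M (H k)"
    "sq_integrable M (P k)" "sq_integrable M (\<lambda>\<omega>. X k \<omega> - Z k \<omega>)"
    by blast+
qed

text \<open>
  The noise terms are martingale differences, so mixed terms vanish in the mean.
\<close>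

lemma noise_sum_le:
  assumes "p \<le> k"
  shows "expectation (\<lambda>\<omega>. (norm (\<Sum>i\<in>{p..<k}. c i *\<^sub>R noise i \<omega>))\<^sup>2) \<le> \<sigma>\<^sup>2 * (\<Sum>i\<in>{p..<k}. (c i)\<^sup>2)"
  using assms
proof (induction k rule: dec_induct)
  case (step k)
  define S where "S \<omega> = (\<Sum>i\<in>{p..<k}. c i *\<^sub>R noise i \<omega>)" for \<omega>
  have S: "sq_integrable M S"
    unfolding S_def[abs_def]
    by (intro sq_integrable_sum sq_integrable_scaleR sq_integrable_noise(1))
  have S_past: "S \<in> borel_measurable (F k)"
    unfolding S_def[abs_def] using noise_past
    by (intro borel_measurable_sum borel_measurable_scaleR) auto
  have ints: "integrable M (\<lambda>\<omega>. (norm (S \<omega>))\<^sup>2)" "integrable M (\<lambda>\<omega>. S \<omega> \<bullet> noise k \<omega>)"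
    "integrable M (\<lambda>\<omega>. (norm (noise k \<omega>))\<^sup>2)"
    using S sq_integrable_noise(1)[of k] by (auto intro: sq_integrable_norm)
  have "(norm (\<Sum>i\<in>{p..<Suc k}. c i *\<^sub>R noise i \<omega>))\<^sup>2
      = (norm (S \<omega>))\<^sup>2 + 2 * c k * (S \<omega> \<bullet> noise k \<omega>) + (c k)\<^sup>2 * (norm (noise k \<omega>))\<^sup>2" for \<omega>
  proof -
    have "(norm (a + t *\<^sub>R b))\<^sup>2 = (norm a)\<^sup>2 + 2 * t * (a \<bullet> b) + t\<^sup>2 * (norm b)\<^sup>2" for a b :: 'a and t
      unfolding power2_norm_eq_inner
      by (simp add: inner_add_left inner_add_right inner_commute power2_eq_square algebra_simps)
    then show ?thesis using step.hyps(1) by (simp add: S_def)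
  qed
  then have "expectation (\<lambda>\<omega>. (norm (\<Sum>i\<in>{p..<Suc k}. c i *\<^sub>R noise i \<omega>))\<^sup>2)
      = expectation (\<lambda>\<omega>. (norm (S \<omega>))\<^sup>2) + (c k)\<^sup>2 * expectation (\<lambda>\<omega>. (norm (noise k \<omega>))\<^sup>2)"
    using ints noise_orthogonal[OF S_past S] by simp
  also have "\<dots> \<le> \<sigma>\<^sup>2 * (\<Sum>i\<in>{p..<k}. (c i)\<^sup>2) + (c k)\<^sup>2 * \<sigma>\<^sup>2"
    using step.IH sq_integrable_noise(2)[of k] by (intro add_mono mult_left_mono) (simp_all add: S_def)
  finally show ?case using step.hyps(1) by (simp add: algebra_simps)
qed simp

abbreviation sq_mean :: "('w \<Rightarrow> 'a) \<Rightarrow> real" where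
  "sq_mean U \<equiv> expectation (\<lambda>\<omega>. (norm (U \<omega>))\<^sup>2)"

text \<open>
  The stochastic gradients in the delay are split into mean and noise. The noise is orthogonal and
  costs only the sum of the squared coefficients; the means are bounded by the Cauchy-Schwarz
  inequality.
\<close>

lemma delay_sq_mean:
  "\<exists>p. real (k - p) \<le> r \<and>
    sq_mean (\<lambda>\<omega>. X k \<omega> - Z k \<omega>) \<le> 4 * r * \<gamma>\<^sup>2 * ((\<Sum>i\<in>{p..<k}. sq_mean (H i)) + \<sigma>\<^sup>2)"
proof -
  obtain p c where p: "p \<le> k" "real (k - p) \<le> r" and c: "(\<Sum>i\<in>{p..<k}. (c i)\<^sup>2) \<le> 2 * r * \<gamma>\<^sup>2"
    and XZ: "\<And>\<omega>. X k \<omega> - Z k \<omega> = (\<Sum>i\<in>{p..<k}. c i *\<^sub>R g (Z i \<omega>) (\<xi> i \<omega>))"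
    using delay[of k] by blast
  define A where "A = (\<Sum>i\<in>{p..<k}. (c i)\<^sup>2)"
  have A: "0 \<le> A" by (simp add: A_def sum_nonneg)
  note sq_int = sq_integrable_iterates sq_integrable_noise(1)
  have "(norm (X k \<omega> - Z k \<omega>))\<^sup>2 \<le> 2 * (A * (\<Sum>i\<in>{p..<k}. (norm (H i \<omega>))\<^sup>2))
      + 2 * (norm (\<Sum>i\<in>{p..<k}. c i *\<^sub>R noise i \<omega>))\<^sup>2" for \<omega>
  proof -
    have "X k \<omega> - Z k \<omega> = (\<Sum>i\<in>{p..<k}. c i *\<^sub>R H i \<omega>) + (\<Sum>i\<in>{p..<k}. c i *\<^sub>R noise i \<omega>)"
      by (simp add: XZ noise_def G_def scaleR_right_diff_distrib sum_subtractf)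
    then have "(norm (X k \<omega> - Z k \<omega>))\<^sup>2 \<le> 2 * (norm (\<Sum>i\<in>{p..<k}. c i *\<^sub>R H i \<omega>))\<^sup>2
        + 2 * (norm (\<Sum>i\<in>{p..<k}. c i *\<^sub>R noise i \<omega>))\<^sup>2"
      using norm_add_sq_le by metis
    moreover have "(norm (\<Sum>i\<in>{p..<k}. c i *\<^sub>R H i \<omega>))\<^sup>2 \<le> (\<Sum>i\<in>{p..<k}. \<bar>c i\<bar> * norm (H i \<omega>))\<^sup>2"
      using sum_norm_le[of "{p..<k}" "\<lambda>i. c i *\<^sub>R H i \<omega>" "\<lambda>i. \<bar>c i\<bar> * norm (H i \<omega>)"]
      by (intro power_mono) auto
    moreover have "(\<Sum>i\<in>{p..<k}. \<bar>c i\<bar> * norm (H i \<omega>))\<^sup>2 \<le> A * (\<Sum>i\<in>{p..<k}. (norm (H i \<omega>))\<^sup>2)"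
      using Cauchy_Schwarz_ineq_sum[of "\<lambda>i. \<bar>c i\<bar>" "\<lambda>i. norm (H i \<omega>)" "{p..<k}"]
      by (simp add: A_def)
    ultimately show ?thesis by linarith
  qed
  then have "sq_mean (\<lambda>\<omega>. X k \<omega> - Z k \<omega>) \<le> expectation (\<lambda>\<omega>.
      2 * (A * (\<Sum>i\<in>{p..<k}. (norm (H i \<omega>))\<^sup>2)) + 2 * (norm (\<Sum>i\<in>{p..<k}. c i *\<^sub>R noise i \<omega>))\<^sup>2)"
    by (intro integral_mono sq_integrable_norm Bochner_Integration.integrable_add
        integrable_mult_right Bochner_Integration.integrable_sum
        sq_integrable_sum sq_integrable_scaleR sq_integrable_noise(1) sq_integrable_iterates)
  also have "\<dots> = 2 * (A * (\<Sum>i\<in>{p..<k}. sq_mean (H i)))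
      + 2 * sq_mean (\<lambda>\<omega>. \<Sum>i\<in>{p..<k}. c i *\<^sub>R noise i \<omega>)"
  proof -
    have "integrable M (\<lambda>\<omega>. (norm (H i \<omega>))\<^sup>2)" for i
      by (rule sq_integrable_norm[OF sq_int(2)])
    moreover have "integrable M (\<lambda>\<omega>. (norm (\<Sum>i\<in>{p..<k}. c i *\<^sub>R noise i \<omega>))\<^sup>2)"
      by (intro sq_integrable_norm sq_integrable_sum sq_integrable_scaleR sq_integrable_noise(1))
    ultimately show ?thesis by simp
  qed
  also have "\<dots> \<le> 2 * (A * (\<Sum>i\<in>{p..<k}. sq_mean (H i))) + 2 * (\<sigma>\<^sup>2 * A)"
    using noise_sum_le[OF p(1), of c] by (simp add: A_def)
  also have "\<dots> = 2 * A * ((\<Sum>i\<in>{p..<k}. sq_mean (H i)) + \<sigma>\<^sup>2)"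
    by (simp add: algebra_simps)
  also have "\<dots> \<le> 2 * (2 * r * \<gamma>\<^sup>2) * ((\<Sum>i\<in>{p..<k}. sq_mean (H i)) + \<sigma>\<^sup>2)"
    using c by (intro mult_right_mono mult_left_mono) (auto simp: A_def intro!: add_nonneg_nonneg sum_nonneg)
  finally show ?thesis using p(2) by (intro exI[of _ p]) simp
qed

lemma sum_drift_le:
  "(\<Sum>k<K. sq_mean (\<lambda>\<omega>. P k \<omega> - H k \<omega>))
    \<le> 4 * r * \<gamma>\<^sup>2 * L\<^sup>2 * (r * (\<Sum>k<K. sq_mean (H k)) + real K * \<sigma>\<^sup>2)"
proof -
  obtain p where p: "\<And>k. real (k - p k) \<le> r"
    and XZ: "\<And>k. sq_mean (\<lambda>\<omega>. X k \<omega> - Z k \<omega>)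
      \<le> 4 * r * \<gamma>\<^sup>2 * ((\<Sum>i\<in>{p k..<k}. sq_mean (H i)) + \<sigma>\<^sup>2)"
  proof -
    have "\<exists>p. \<forall>k. real (k - p k) \<le> r \<and> sq_mean (\<lambda>\<omega>. X k \<omega> - Z k \<omega>)
        \<le> 4 * r * \<gamma>\<^sup>2 * ((\<Sum>i\<in>{p k..<k}. sq_mean (H i)) + \<sigma>\<^sup>2)"
      by (rule choice) (use delay_sq_mean in blast)
    then show thesis using that by blast
  qed
  have r: "r \<ge> 0" using p[of 0] by simp
  have "sq_mean (\<lambda>\<omega>. P k \<omega> - H k \<omega>)
      \<le> L\<^sup>2 * (4 * r * \<gamma>\<^sup>2 * ((\<Sum>i\<in>{p k..<k}. sq_mean (H i)) + \<sigma>\<^sup>2))" for k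
  proof -
    have "sq_mean (\<lambda>\<omega>. P k \<omega> - H k \<omega>) \<le> expectation (\<lambda>\<omega>. L\<^sup>2 * (norm (X k \<omega> - Z k \<omega>))\<^sup>2)"
    proof (rule integral_mono)
      show "integrable M (\<lambda>\<omega>. (norm (P k \<omega> - H k \<omega>))\<^sup>2)"
        using sq_integrable_iterates by (intro sq_integrable_norm) auto
      show "integrable M (\<lambda>\<omega>. L\<^sup>2 * (norm (X k \<omega> - Z k \<omega>))\<^sup>2)"
        using sq_integrable_norm[OF sq_integrable_iterates(4)] by simp
      show "(norm (P k \<omega> - H k \<omega>))\<^sup>2 \<le> L\<^sup>2 * (norm (X k \<omega> - Z k \<omega>))\<^sup>2" for \<omega>
        unfolding P_def H_def power_mult_distrib[symmetric]
        by (rule power_mono) (simp_all add: f'_lipschitz)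
    qed
    also have "\<dots> = L\<^sup>2 * sq_mean (\<lambda>\<omega>. X k \<omega> - Z k \<omega>)" by simp
    also have "\<dots> \<le> L\<^sup>2 * (4 * r * \<gamma>\<^sup>2 * ((\<Sum>i\<in>{p k..<k}. sq_mean (H i)) + \<sigma>\<^sup>2))"
      using XZ[of k] by (rule mult_left_mono) simp
    finally show ?thesis .
  qed
  then have "(\<Sum>k<K. sq_mean (\<lambda>\<omega>. P k \<omega> - H k \<omega>))
      \<le> (\<Sum>k<K. L\<^sup>2 * (4 * r * \<gamma>\<^sup>2 * ((\<Sum>i\<in>{p k..<k}. sq_mean (H i)) + \<sigma>\<^sup>2)))"
    by (intro sum_mono)
  also have "\<dots> = 4 * r * \<gamma>\<^sup>2 * L\<^sup>2 * ((\<Sum>k<K. \<Sum>i\<in>{p k..<k}. sq_mean (H i)) + real K * \<sigma>\<^sup>2)"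
    unfolding sum_distrib_left[symmetric] sum.distrib by (simp add: mult_ac)
  also have "\<dots> \<le> 4 * r * \<gamma>\<^sup>2 * L\<^sup>2 * (r * (\<Sum>k<K. sq_mean (H k)) + real K * \<sigma>\<^sup>2)"
    using r by (intro mult_left_mono add_right_mono sum_window_le p) auto
  finally show ?thesis .
qed

text \<open>
  The descent inequality is summed along each trajectory before expectations are taken. The values
  of \<open>f\<close> then telescope and the last one is at least \<open>f w0 - \<Delta>\<close>, so that integrability of the random
  variables \<open>f (X k)\<close> never enters.
\<close>

lemma sum_descent:
  "(\<Sum>k<K. sq_mean (P k)) + (\<Sum>k<K. sq_mean (H k)) - (\<Sum>k<K. sq_mean (\<lambda>\<omega>. P k \<omega> - H k \<omega>))
    \<le> 2 * \<Delta> / \<gamma> + L * \<gamma> * ((\<Sum>k<K. sq_mean (H k)) + real K * \<sigma>\<^sup>2)"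
proof -
  note sq_int = sq_integrable_iterates sq_integrable_noise(1)
  define Y where "Y k \<omega> = L / 2 * \<gamma>\<^sup>2 * (norm (G k \<omega>))\<^sup>2 - \<gamma> * (P k \<omega> \<bullet> G k \<omega>)" for k \<omega>
  have int_Y: "integrable M (Y k)" for k
    unfolding Y_def[abs_def] using sq_int
    by (intro Bochner_Integration.integrable_diff integrable_mult_right
        sq_integrable_norm sq_integrable_inner) auto
  have path: "f (X K \<omega>) \<le> f w0 + (\<Sum>k<K. Y k \<omega>)" for \<omega>
  proof (induction K)
    case (Suc K)
    have "f (X (Suc K) \<omega>) \<le> f (X K \<omega>) + Y K \<omega>"
      using lipschitz_gradient_upper_bound[OF gradient smooth, of "X (Suc K) \<omega>" "X K \<omega>"]
      by (simp add: X_Suc Y_def P_def G_def power_mult_distrib)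
    with Suc show ?case by simp
  qed (simp add: X_0)
  have EY: "expectation (Y k) \<le> L / 2 * \<gamma>\<^sup>2 * (sq_mean (H k) + \<sigma>\<^sup>2)
      - \<gamma> / 2 * (sq_mean (P k) + sq_mean (H k) - sq_mean (\<lambda>\<omega>. P k \<omega> - H k \<omega>))" for k
  proof -
    have Y: "Y k \<omega> = L / 2 * \<gamma>\<^sup>2 * ((norm (H k \<omega>))\<^sup>2 + 2 * (H k \<omega> \<bullet> noise k \<omega>) + (norm (noise k \<omega>))\<^sup>2)
        - \<gamma> / 2 * ((norm (P k \<omega>))\<^sup>2 + (norm (H k \<omega>))\<^sup>2 - (norm (P k \<omega> - H k \<omega>))\<^sup>2 + 2 * (P k \<omega> \<bullet> noise k \<omega>))" for \<omega>
    proof -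
      have G: "G k \<omega> = H k \<omega> + noise k \<omega>" by (simp add: noise_def)
      show ?thesis
        unfolding Y_def G power2_norm_eq_inner
        by (simp add: inner_add_left inner_add_right inner_diff_left inner_diff_right inner_commute field_simps)
    qed
    have ints: "integrable M (\<lambda>\<omega>. (norm (H k \<omega>))\<^sup>2)" "integrable M (\<lambda>\<omega>. H k \<omega> \<bullet> noise k \<omega>)"
      "integrable M (\<lambda>\<omega>. (norm (noise k \<omega>))\<^sup>2)" "integrable M (\<lambda>\<omega>. (norm (P k \<omega>))\<^sup>2)"
      "integrable M (\<lambda>\<omega>. (norm (P k \<omega> - H k \<omega>))\<^sup>2)" "integrable M (\<lambda>\<omega>. P k \<omega> \<bullet> noise k \<omega>)"
      using sq_int by (auto intro!: sq_integrable_norm)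
    have "expectation (\<lambda>\<omega>. H k \<omega> \<bullet> noise k \<omega>) = 0" "expectation (\<lambda>\<omega>. P k \<omega> \<bullet> noise k \<omega>) = 0"
      by (rule noise_orthogonal; use H_past P_past sq_int in simp)+
    then have "expectation (Y k) = L / 2 * \<gamma>\<^sup>2 * (sq_mean (H k) + sq_mean (noise k))
        - \<gamma> / 2 * (sq_mean (P k) + sq_mean (H k) - sq_mean (\<lambda>\<omega>. P k \<omega> - H k \<omega>))"
      unfolding Y[abs_def] using ints by simp
    moreover have "L / 2 * \<gamma>\<^sup>2 * (sq_mean (H k) + sq_mean (noise k))
        \<le> L / 2 * \<gamma>\<^sup>2 * (sq_mean (H k) + \<sigma>\<^sup>2)"
      using sq_integrable_noise(2)[of k] L_nonneg by (intro mult_left_mono) simp_all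
    ultimately show ?thesis by simp
  qed
  have "0 \<le> expectation (\<lambda>\<omega>. \<Delta> + (\<Sum>k<K. Y k \<omega>))"
  proof (rule integral_nonneg_AE, rule AE_I2)
    fix \<omega>
    show "0 \<le> \<Delta> + (\<Sum>k<K. Y k \<omega>)" using path[of \<omega>] gap[of "X K \<omega>"] by linarith
  qed
  also have "\<dots> = \<Delta> + (\<Sum>k<K. expectation (Y k))"
    using int_Y by (simp add: prob_space)
  also have "\<dots> \<le> \<Delta> + (\<Sum>k<K. L / 2 * \<gamma>\<^sup>2 * (sq_mean (H k) + \<sigma>\<^sup>2)
      - \<gamma> / 2 * (sq_mean (P k) + sq_mean (H k) - sq_mean (\<lambda>\<omega>. P k \<omega> - H k \<omega>)))"
    by (intro add_left_mono sum_mono EY)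
  also have "\<dots> = \<Delta> + L / 2 * \<gamma>\<^sup>2 * ((\<Sum>k<K. sq_mean (H k)) + real K * \<sigma>\<^sup>2)
      - \<gamma> / 2 * ((\<Sum>k<K. sq_mean (P k)) + (\<Sum>k<K. sq_mean (H k))
        - (\<Sum>k<K. sq_mean (\<lambda>\<omega>. P k \<omega> - H k \<omega>)))"
    unfolding sum_subtractf sum_distrib_left[symmetric] sum.distrib by simp
  finally have "0 \<le> \<Delta> + L / 2 * \<gamma>\<^sup>2 * ((\<Sum>k<K. sq_mean (H k)) + real K * \<sigma>\<^sup>2)
      - \<gamma> / 2 * ((\<Sum>k<K. sq_mean (P k)) + (\<Sum>k<K. sq_mean (H k))
        - (\<Sum>k<K. sq_mean (\<lambda>\<omega>. P k \<omega> - H k \<omega>)))" .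
  moreover have "T \<le> 2 * \<Delta> / \<gamma> + L * \<gamma> * Q" if "0 \<le> \<Delta> + L / 2 * \<gamma>\<^sup>2 * Q - \<gamma> / 2 * T" for Q T
  proof -
    have "0 \<le> 2 / \<gamma> * (\<Delta> + L / 2 * \<gamma>\<^sup>2 * Q - \<gamma> / 2 * T)"
      using that gamma_pos by (intro mult_nonneg_nonneg) auto
    also have "\<dots> = 2 * \<Delta> / \<gamma> + L * \<gamma> * Q - T"
      using gamma_pos by (simp add: field_simps power2_eq_square)
    finally show ?thesis by simp
  qed
  ultimately show ?thesis by blast
qed

proposition rate:
  assumes \<epsilon>: "\<epsilon> > 0"
    and step: "2 * L * \<gamma> \<le> 1" "4 * r * L * \<gamma> \<le> 1" "8 * \<sigma>\<^sup>2 * L * \<gamma> \<le> \<epsilon>"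
    and tight: "2 * L * \<gamma> = 1 \<or> 4 * r * L * \<gamma> = 1 \<or> 8 * \<sigma>\<^sup>2 * L * \<gamma> = \<epsilon>"
    and K: "8 * (r + 1) * L * \<Delta> / \<epsilon> + 16 * \<sigma>\<^sup>2 * L * \<Delta> / \<epsilon>\<^sup>2 \<le> real K"
  shows "(\<Sum>k<K. sq_mean (P k)) \<le> real K * \<epsilon>"
proof (rule scaled_rate)
  let ?\<tau> = "L * \<gamma>" and ?\<rho> = "r * L * \<gamma>" and ?\<nu> = "\<sigma>\<^sup>2 * L * \<gamma> / \<epsilon>" and ?h = "\<Delta> / \<gamma>"
  have r: "r \<ge> 0" using delay[of 0] by simp
  have \<Delta>: "\<Delta> \<ge> 0" using gap[of w0] by simp
  show "0 \<le> ?\<tau>" "0 \<le> ?\<rho>" "0 \<le> ?\<nu>" "0 \<le> ?h" "0 \<le> real K * \<epsilon>"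
    using L_nonneg gamma_pos r \<Delta> \<epsilon> by simp_all
  show "0 \<le> (\<Sum>k<K. sq_mean (H k))" by (intro sum_nonneg) simp
  show "?\<tau> \<le> 1/2" "?\<rho> \<le> 1/4" "?\<nu> \<le> 1/8" "?\<tau> = 1/2 \<or> ?\<rho> = 1/4 \<or> ?\<nu> = 1/8"
    using step tight \<epsilon> by (auto simp: field_simps)
  have "?h * (8 * (?\<rho> + ?\<tau>) + 16 * ?\<nu>)
      = (8 * (r + 1) * L * \<Delta> / \<epsilon> + 16 * \<sigma>\<^sup>2 * L * \<Delta> / \<epsilon>\<^sup>2) * \<epsilon>"
    using gamma_pos \<epsilon> by (simp add: field_simps power2_eq_square)
  also have "\<dots> \<le> real K * \<epsilon>"
    using K \<epsilon> by (intro mult_right_mono) auto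
  finally show "?h * (8 * (?\<rho> + ?\<tau>) + 16 * ?\<nu>) \<le> real K * \<epsilon>" .
  show "(\<Sum>k<K. sq_mean (P k)) + (\<Sum>k<K. sq_mean (H k)) - (\<Sum>k<K. sq_mean (\<lambda>\<omega>. P k \<omega> - H k \<omega>))
      \<le> 2 * ?h + ?\<tau> * (\<Sum>k<K. sq_mean (H k)) + ?\<nu> * (real K * \<epsilon>)"
    using sum_descent[of K] \<epsilon> by (simp add: algebra_simps)
  show "(\<Sum>k<K. sq_mean (\<lambda>\<omega>. P k \<omega> - H k \<omega>))
      \<le> 4 * ?\<rho>\<^sup>2 * (\<Sum>k<K. sq_mean (H k)) + 4 * ?\<rho> * ?\<nu> * (real K * \<epsilon>)"
    using sum_drift_le[of K] \<epsilon> by (simp add: algebra_simps power2_eq_square)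
  have "sq_mean (P k) \<le> 2 * sq_mean (H k) + 2 * sq_mean (\<lambda>\<omega>. P k \<omega> - H k \<omega>)" for k
  proof -
    have "sq_mean (P k) \<le> expectation (\<lambda>\<omega>. 2 * (norm (H k \<omega>))\<^sup>2 + 2 * (norm (P k \<omega> - H k \<omega>))\<^sup>2)"
    proof (rule integral_mono)
      show "integrable M (\<lambda>\<omega>. 2 * (norm (H k \<omega>))\<^sup>2 + 2 * (norm (P k \<omega> - H k \<omega>))\<^sup>2)"
        using sq_integrable_iterates
        by (intro Bochner_Integration.integrable_add integrable_mult_right
            sq_integrable_norm) auto
      show "(norm (P k \<omega>))\<^sup>2 \<le> 2 * (norm (H k \<omega>))\<^sup>2 + 2 * (norm (P k \<omega> - H k \<omega>))\<^sup>2" for \<omega>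
        using norm_add_sq_le[of "H k \<omega>" "P k \<omega> - H k \<omega>"] by simp
    qed (intro sq_integrable_norm sq_integrable_iterates)
    also have "\<dots> = 2 * sq_mean (H k) + 2 * sq_mean (\<lambda>\<omega>. P k \<omega> - H k \<omega>)"
    proof -
      have "integrable M (\<lambda>\<omega>. (norm (H k \<omega>))\<^sup>2)" "integrable M (\<lambda>\<omega>. (norm (P k \<omega> - H k \<omega>))\<^sup>2)"
        using sq_integrable_iterates by (auto intro!: sq_integrable_norm)
      then show ?thesis by simp
    qed
    finally show ?thesis .
  qed
  then have "(\<Sum>k<K. sq_mean (P k)) \<le> (\<Sum>k<K. 2 * sq_mean (H k) + 2 * sq_mean (\<lambda>\<omega>. P k \<omega> - H k \<omega>))"
    by (intro sum_mono)
  then show "(\<Sum>k<K. sq_mean (P k))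
      \<le> 2 * (\<Sum>k<K. sq_mean (H k)) + 2 * (\<Sum>k<K. sq_mean (\<lambda>\<omega>. P k \<omega> - H k \<omega>))"
    by (simp add: sum.distrib sum_distrib_left)
qed

end

section \<open>Convergence of methods given by a computation tree\<close>

lemma ereal_le_divide_ereal_iff:
  assumes "a > 0" and "d \<ge> 0"
  shows "ereal s \<le> ereal a / ereal d \<longleftrightarrow> s * d \<le> a" and "ereal s = ereal a / ereal d \<Longrightarrow> s * d = a"
  using assms by (auto simp: ereal_divide field_simps split: if_splits)

text \<open>
  Multiplying out the fractions makes the cases \<open>r = 0\<close> and \<open>\<sigma> = 0\<close> uniform with the others: a
  vanishing denominator stands for the value \<open>\<infinity>\<close>, and the inequality becomes a triviality.
\<close>

lemma main_step_bounds:
  assumes L: "L > 0" and \<epsilon>: "\<epsilon> > 0" and r: "r \<ge> 0" and s: "ereal s = main_step L \<sigma> \<epsilon> (ereal r)"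
  shows "2 * L * s \<le> 1" and "4 * r * L * s \<le> 1" and "8 * \<sigma>\<^sup>2 * L * s \<le> \<epsilon>"
    and "2 * L * s = 1 \<or> 4 * r * L * s = 1 \<or> 8 * \<sigma>\<^sup>2 * L * s = \<epsilon>"
proof -
  have step: "main_step L \<sigma> \<epsilon> (ereal r) = min (ereal 1 / ereal (2 * L))
      (min (ereal 1 / ereal (4 * r * L)) (ereal \<epsilon> / ereal (8 * \<sigma>\<^sup>2 * L)))"
    by (simp add: main_step_def one_ereal_def numeral_eq_ereal)
  have d: "0 \<le> 2 * L" "0 \<le> 4 * r * L" "0 \<le> 8 * \<sigma>\<^sup>2 * L" using L r by auto
  have le: "ereal s \<le> ereal 1 / ereal (2 * L)" "ereal s \<le> ereal 1 / ereal (4 * r * L)"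
    "ereal s \<le> ereal \<epsilon> / ereal (8 * \<sigma>\<^sup>2 * L)"
    unfolding s step by (auto simp: min_le_iff_disj)
  show "2 * L * s \<le> 1" "4 * r * L * s \<le> 1" "8 * \<sigma>\<^sup>2 * L * s \<le> \<epsilon>"
    using le ereal_le_divide_ereal_iff(1)[OF _ d(1), of 1 s] ereal_le_divide_ereal_iff(1)[OF _ d(2), of 1 s]
      ereal_le_divide_ereal_iff(1)[OF \<epsilon> d(3), of s] by (simp_all add: mult_ac)
  have "ereal s = ereal 1 / ereal (2 * L) \<or> ereal s = ereal 1 / ereal (4 * r * L)
      \<or> ereal s = ereal \<epsilon> / ereal (8 * \<sigma>\<^sup>2 * L)"
    unfolding s step by (auto simp: min_def)
  then show "2 * L * s = 1 \<or> 4 * r * L * s = 1 \<or> 8 * \<sigma>\<^sup>2 * L * s = \<epsilon>"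
    using ereal_le_divide_ereal_iff(2)[OF _ d(1), of 1 s] ereal_le_divide_ereal_iff(2)[OF _ d(2), of 1 s]
      ereal_le_divide_ereal_iff(2)[OF \<epsilon> d(3), of s] by (auto simp: mult_ac)
qed

theorem theoremF1:
  fixes f :: "real ^ 'd \<Rightarrow> real" and f' :: "real ^ 'd \<Rightarrow> real ^ 'd"
    and g :: "real ^ 'd \<Rightarrow> 's \<Rightarrow> real ^ 'd"
    and M :: "'w measure" and D :: "'s measure"
    and L \<sigma> \<epsilon> :: real and R \<Delta> :: ereal
    and w0 :: "real ^ 'd" and base grad :: "nat \<Rightarrow> nat" and step :: "nat \<Rightarrow> real"
    and sample :: "nat \<Rightarrow> 'w \<Rightarrow> 's" and w :: "nat \<Rightarrow> 'w \<Rightarrow> real ^ 'd"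
    and x :: "nat \<Rightarrow> nat"
    and \<gamma> :: "nat \<Rightarrow> real" and z :: "nat \<Rightarrow> nat" and \<xi> :: "nat \<Rightarrow> 'w \<Rightarrow> 's"
    and K :: nat
  assumes "prob_space M" and "prob_space D"
    and gradient: "\<And>y. GDERIV f y :> f' y"
    and L_pos: "L > 0"
    and L_smooth: "L-lipschitz_on UNIV f'"
    and Delta: "\<Delta> = ereal (f w0) - (INF y. ereal (f y))"
    and g_measurable: "(\<lambda>(y, s). g y s) \<in> borel_measurable (borel \<Otimes>\<^sub>M D)"
    and g_unbiased: "\<And>y. has_bochner_integral D (g y) (f' y)"
    and g_variance: "\<And>y. (\<integral>\<^sup>+ s. ennreal ((norm (g y s - f' y))\<^sup>2) \<partial>D) \<le> ennreal (\<sigma>\<^sup>2)"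
    and eps_pos: "\<epsilon> > 0"
    and tree: "computation_tree M D g w0 base grad step sample w"
    and branch: "main_branch base x"
    and auxiliary: "auxiliary_sequence grad step sample x \<gamma> z \<xi>"
    and cond1: "\<And>k. independent_vars M D (\<xi> k)
      (\<Pi>\<^sub>M i\<in>{..<k}. (borel \<Otimes>\<^sub>M borel \<Otimes>\<^sub>M D))
      (\<lambda>\<omega>. \<lambda>i\<in>{..<k}. (w (x (Suc i)) \<omega>, w (z (Suc i)) \<omega>, \<xi> i \<omega>))"
    and cond2: "\<And>k. repr base grad sample w (z k) \<subseteq># repr base grad sample w (x k)"
    and R_nonneg: "0 \<le> R"
    and cond3: "\<And>k. ereal (real (tree_dist base (x k) (z k))) \<le> R"
    and cond4_main: "\<And>k. ereal (\<gamma> k) = main_step L \<sigma> \<epsilon> R"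
    and cond4_other: "\<And>n. n > 0 \<Longrightarrow> n \<notin> range x \<Longrightarrow>
      ereal (step n) \<le>
        ereal (aux_step_factor R (branch_dist base (base n) x)) * main_step L \<sigma> \<epsilon> R"
    and K_large: "ereal (real K) \<ge>
      8 * (R + 1) * ereal L * \<Delta> / ereal \<epsilon> + 16 * ereal (\<sigma>\<^sup>2) * ereal L * \<Delta> / ereal (\<epsilon>\<^sup>2)"
  shows "(1 / of_nat K) * (\<Sum>k<K. \<integral>\<^sup>+ \<omega>. ennreal ((norm (f' (w (x k) \<omega>)))\<^sup>2) \<partial>M) \<le> ennreal \<epsilon>"
proof -
  interpret prob_space M by fact
  interpret computation_tree M D g w0 base grad step sample w by fact
  define s where "s = \<gamma> 0"
  have aux: "\<gamma> k = step (x (Suc k))" "z k = grad (x (Suc k))" "\<xi> k = sample (x (Suc k))" for k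
    using auxiliary by (simp_all add: auxiliary_sequence_def)
  have x_pos: "x (Suc k) > 0" for k by (rule main_branch_simps(3)[OF branch])
  have s_pos: "s > 0" using step_pos[OF x_pos] by (simp add: s_def aux(1))
  have s_main: "ereal s = main_step L \<sigma> \<epsilon> R" by (simp add: s_def cond4_main)
  have step_main: "step (x (Suc k)) = s" for k
  proof -
    have "ereal (\<gamma> k) = ereal (\<gamma> 0)" by (simp only: cond4_main)
    then show ?thesis by (simp add: s_def aux(1))
  qed

  \<comment> \<open>An infinite \<open>R\<close> would make the main step size vanish.\<close>
  have "R \<noteq> \<infinity>"
  proof
    assume "R = \<infinity>"
    then have "1 / (4 * R * ereal L) = 0" using L_pos by simp
    then have "ereal s \<le> 0" unfolding s_main main_step_def by (simp add: min_le_iff_disj)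
    with s_pos show False by simp
  qed
  then obtain r where R: "R = ereal r" and r: "r \<ge> 0"
    using R_nonneg by (cases R) auto

  obtain \<delta> where \<delta>: "\<Delta> = ereal \<delta>" and gap: "\<And>y. f w0 - f y \<le> \<delta>"
  proof (cases "INF y. ereal (f y)")
    case (real m)
    have "f w0 - f y \<le> f w0 - m" for y
      using INF_lower[of y UNIV "\<lambda>y. ereal (f y)"] real by simp
    moreover have "\<Delta> = ereal (f w0 - m)" using Delta real by simp
    ultimately show thesis using that by blast
  next
    case PInf
    then show thesis using INF_lower[of w0 UNIV "\<lambda>y. ereal (f y)"] by simp
  next
    case MInf
    then have "\<Delta> = \<infinity>" using Delta by simp
    then have "8 * (R + 1) * ereal L * \<Delta> / ereal \<epsilon> = \<infinity>"
      using L_pos eps_pos r by (simp add: R one_ereal_def)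
    moreover have "0 \<le> 16 * ereal (\<sigma>\<^sup>2) * ereal L * \<Delta> / ereal (\<epsilon>\<^sup>2)"
      using L_pos eps_pos \<open>\<Delta> = \<infinity>\<close> by simp
    ultimately show thesis using K_large by simp
  qed
  have K: "8 * (r + 1) * L * \<delta> / \<epsilon> + 16 * \<sigma>\<^sup>2 * L * \<delta> / \<epsilon>\<^sup>2 \<le> real K"
    using K_large eps_pos by (simp add: R \<delta> one_ereal_def)

  have delay: "\<exists>p\<le>k. \<exists>c. real (k - p) \<le> r \<and> (\<Sum>i\<in>{p..<k}. (c i)\<^sup>2) \<le> 2 * r * s\<^sup>2 \<and>
      (\<forall>\<omega>. w (x k) \<omega> - w (z k) \<omega> = (\<Sum>i\<in>{p..<k}. c i *\<^sub>R g (w (z i) \<omega>) (\<xi> i \<omega>)))" for k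
  proof -
    have other: "step n \<le> aux_step_factor (ereal r) (branch_dist base (base n) x) * s"
      if "n > 0" "n \<notin> range x" for n
      using cond4_other[OF that] unfolding s_main[symmetric] by (simp add: R)
    have dist: "real (tree_dist base (x k) (grad (x (Suc k)))) \<le> r"
      using cond3[of k] by (simp add: R aux)
    show ?thesis
      unfolding aux
      by (rule delayed_main_branch[OF branch step_main cond2[of k, unfolded aux] dist other]) blast+
  qed

  define N :: "nat \<Rightarrow> (nat \<Rightarrow> (real ^ 'd) \<times> (real ^ 'd) \<times> 's) measure"
    where "N k = (\<Pi>\<^sub>M i\<in>{..<k}. (borel \<Otimes>\<^sub>M borel \<Otimes>\<^sub>M D))" for k
  define Y where "Y k \<omega> = (\<lambda>i\<in>{..<k}. (w (x (Suc i)) \<omega>, w (z (Suc i)) \<omega>, \<xi> i \<omega>))" for k \<omega>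
  define F where "F k = vimage_algebra (space M) (Y k) (N k)" for k
  have [measurable]: "w n \<in> borel_measurable M" for n by (rule node_measurable[OF g_measurable])
  have \<xi>_meas [measurable]: "\<xi> k \<in> M \<rightarrow>\<^sub>M D" for k unfolding aux by (rule sample_measurable[OF x_pos])
  have Y_meas: "Y k \<in> M \<rightarrow>\<^sub>M N k" for k
    unfolding Y_def[abs_def] N_def by measurable
  have Y_F: "Y k \<in> F k \<rightarrow>\<^sub>M N k" for k
    unfolding F_def using measurable_space[OF Y_meas] by (intro measurable_vimage_algebra1) auto
  have comp: "(\<lambda>\<omega>. (w (x (Suc i)) \<omega>, w (z (Suc i)) \<omega>, \<xi> i \<omega>)) \<in> F k \<rightarrow>\<^sub>M borel \<Otimes>\<^sub>M borel \<Otimes>\<^sub>M D"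
    if "i < k" for i k
  proof -
    have "(\<lambda>\<omega>. Y k \<omega> i) \<in> F k \<rightarrow>\<^sub>M borel \<Otimes>\<^sub>M borel \<Otimes>\<^sub>M D"
      using that
      by (intro measurable_compose[OF Y_F[of k, unfolded N_def] measurable_component_singleton]) simp
    then show ?thesis using that by (simp add: Y_def)
  qed

  interpret delayed_sgd M D f f' g L \<sigma> s r \<delta> w0 "\<lambda>k. w (x k)" "\<lambda>k. w (z k)" \<xi> F
  proof (intro delayed_sgd.intro delayed_sgd_axioms.intro)
    show "prob_space M" "prob_space D" by fact+
    show "w (x 0) = (\<lambda>\<omega>. w0)" by (simp add: main_branch_simps(1)[OF branch] root)
    show "w (x (Suc k)) = (\<lambda>\<omega>. w (x k) \<omega> - s *\<^sub>R g (w (z k) \<omega>) (\<xi> k \<omega>))" for k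
      using node[OF x_pos[of k]] by (simp add: main_branch_simps(2)[OF branch] step_main aux)
    show "subalgebra M (F k)" for k
      unfolding subalgebra_def F_def using sets_image_in_sets[OF refl Y_meas[of k]] by simp
    show "w (z i) \<in> borel_measurable (F k)" if "i \<le> k" for i k
    proof (cases i)
      \<comment> \<open>The past of step \<open>0\<close> is trivial; an empty delay sum forces \<open>z 0\<close> to be at the start.\<close>
      case 0
      have "w (z 0) = (\<lambda>\<omega>. w0)"
        using delay[of 0] by (simp add: main_branch_simps(1)[OF branch] root fun_eq_iff)
      then show ?thesis by (simp add: 0)
    next
      case (Suc j)
      then show ?thesis
        using measurable_compose[OF measurable_compose[OF comp[of j k] measurable_snd] measurable_fst] that
        by simp
    qed
    show "\<xi> i \<in> F k \<rightarrow>\<^sub>M D" if "i < k" for i k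
      using measurable_compose[OF measurable_compose[OF comp[OF that] measurable_snd] measurable_snd]
      by simp
    show "distr M D (\<xi> k) = D" for k unfolding aux by (rule sample_distr[OF x_pos])
    show "indep_set (sets (vimage_algebra (space M) (\<xi> k) D)) (sets (F k))" for k
      using cond1[of k] by (simp add: independent_vars_def F_def N_def Y_def[abs_def])
  qed (fact gradient L_smooth gap g_measurable g_unbiased g_variance s_pos delay)+

  have rate: "(\<Sum>k<K. sq_mean (P k)) \<le> real K * \<epsilon>"
    using main_step_bounds[OF L_pos eps_pos r] s_main R by (intro rate[OF eps_pos _ _ _ _ K]) auto
  have "(\<Sum>k<K. \<integral>\<^sup>+ \<omega>. ennreal ((norm (f' (w (x k) \<omega>)))\<^sup>2) \<partial>M) = (\<Sum>k<K. ennreal (sq_mean (P k)))"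
    using sq_integrable_norm[OF sq_integrable_iterates(3)]
    by (intro sum.cong refl) (simp add: nn_integral_eq_integral P_def)
  also have "\<dots> = ennreal (\<Sum>k<K. sq_mean (P k))"
    by (rule sum_ennreal) simp
  also have "\<dots> \<le> ennreal (real K * \<epsilon>)" using rate by (rule ennreal_leI)
  finally have sum: "(\<Sum>k<K. \<integral>\<^sup>+ \<omega>. ennreal ((norm (f' (w (x k) \<omega>)))\<^sup>2) \<partial>M) \<le> ennreal (real K * \<epsilon>)" .
  show ?thesis
  proof (cases "K = 0")
    case False
    then have "1 / of_nat K = ennreal (1 / real K)"
      by (simp add: divide_ennreal[symmetric] ennreal_of_nat_eq_real_of_nat)
    then have "(1 / of_nat K) * (\<Sum>k<K. \<integral>\<^sup>+ \<omega>. ennreal ((norm (f' (w (x k) \<omega>)))\<^sup>2) \<partial>M)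
        \<le> ennreal (1 / real K) * ennreal (real K * \<epsilon>)"
      using sum by (simp add: mult_left_mono)
    also have "\<dots> = ennreal \<epsilon>"
      using False eps_pos by (simp flip: ennreal_mult)
    finally show ?thesis .
  qed simp
qed

end
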